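(* Let $G$ be a finite group and $N\trianglelefteq G$. The following are equivalent: (1) $c_N(u)\neq0$ for some $u\in\Omega(G,\operatorname{NS}(G))^{\times}$; (2) $G/N$ is an elementary abelian $2$-group. Consequently, $$\bigcup_{u\in\Omega(G,\operatorname{NS}(G))^{\times}}\{N\trianglelefteq G\mid c_N(u)\neq0\}=\{N\trianglelefteq G\mid G/N\text{ is an elementary abelian }2\text{-group}\}.$$ The trivial group $G/G$ is regarded as an elementary abelian $2$-group of rank $0$.
   Context: For a finite group $G$, $\Omega(G)$ is the Burnside ring (Grothendieck ring of finite $G$-sets), with $\mathbb Z$-basis $[G/H]$, $(H)$ running over the conjugacy classes of subgroups of $G$. $\operatorname{NS}(G)$ is the set of normal subgroups of $G$. The normal partial Burnside ring is the unital subring $\Omega(G,\operatorname{NS}(G))=\bigoplus_{N\trianglelefteq G}\mathbb Z[G/N]$ of $\Omega(G)$. With $\operatorname{core}_G(H)=\bigcap_{g\in G}gHg^{-1}$, for $x=\sum_{(H)}a_H[G/H]\in\Omega(G)$ and $N\trianglelefteq G$ the $N$-core coefficient is $c_N(x)=\sum_{(H):\,\operatorname{core}_G(H)=N}a_H$. (For $x\in\Omega(G,\operatorname{NS}(G))$ this is just the coefficient of $[G/N]$.) Known result available (cited in the source): $\Omega(G,\operatorname{NS}(G))^{\times}$ is generated by $-1_{\Omega(G)}$ and the elements $1_{\Omega(G)}-[G/N]$ with $N\trianglelefteq G$, $|G:N|=2$. *)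

theory Defs
  imports "HOL-Algebra.Group_Action" "HOL-Algebra.Left_Coset" "HOL-Algebra.Ring"
begin

section \<open>Finite \<open>G\<close>-sets\<close>

type_synonym ('a, 'x) gset = "'x set \<times> ('a \<Rightarrow> 'x \<Rightarrow> 'x)"

definition finite_gset :: "('a, 'm) monoid_scheme \<Rightarrow> ('a, 'x) gset \<Rightarrow> bool" where
  "finite_gset G X \<longleftrightarrow> finite (fst X) \<and> group_action G (fst X) (snd X)"

definition gset_iso :: "('a, 'm) monoid_scheme \<Rightarrow> ('a, 'x) gset \<Rightarrow> ('a, 'y) gset \<Rightarrow> bool" where
  "gset_iso G X Y \<longleftrightarrow>
     (\<exists>f. bij_betw f (fst X) (fst Y) \<and>
          (\<forall>g\<in>carrier G. \<forall>x\<in>fst X. f (snd X g x) = snd Y g (f x)))"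

text \<open>
  The actions below are restricted to their carrier sets because \<^const>\<open>group_action\<close>
  requires extensional functions.
\<close>

definition gset_sum :: "('a, 'x) gset \<Rightarrow> ('a, 'y) gset \<Rightarrow> ('a, 'x + 'y) gset" where
  "gset_sum X Y =
     (fst X <+> fst Y, \<lambda>g. restrict (map_sum (snd X g) (snd Y g)) (fst X <+> fst Y))"

definition gset_prod :: "('a, 'x) gset \<Rightarrow> ('a, 'y) gset \<Rightarrow> ('a, 'x \<times> 'y) gset" where
  "gset_prod X Y =
     (fst X \<times> fst Y, \<lambda>g. restrict (map_prod (snd X g) (snd Y g)) (fst X \<times> fst Y))"

definition gset_empty :: "('a, nat) gset" where
  "gset_empty = ({}, \<lambda>g. \<lambda>x\<in>{}. x)"

definition gset_point :: "('a, nat) gset" where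
  "gset_point = ({0}, \<lambda>g. \<lambda>x\<in>{0}. x)"

definition gset_cosets :: "('a, 'm) monoid_scheme \<Rightarrow> 'a set \<Rightarrow> ('a, 'a set) gset" where
  "gset_cosets G H = (lcosets\<^bsub>G\<^esub> H, \<lambda>g. \<lambda>C\<in>lcosets\<^bsub>G\<^esub> H. g <#\<^bsub>G\<^esub> C)"


section \<open>The Burnside ring\<close>

text \<open>
  The Grothendieck construction on isomorphism classes of finite \<open>G\<close>-sets: \<open>gset_diff G X Y\<close>
  is the formal difference \<open>[X] - [Y]\<close>, that is, the class of \<open>(X, Y)\<close> for the relation
  \<open>(X, Y) \<sim> (X', Y') \<longleftrightarrow> (\<exists>Z. X + Y' + Z \<cong> X' + Y + Z)\<close>.  The members of a class
  are taken with underlying sets of natural numbers, which is no restriction as every finite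
  \<open>G\<close>-set is isomorphic to one of that form; \<open>X\<close> and \<open>Y\<close> themselves may live on any type.
\<close>

type_synonym 'a burnside = "(('a, nat) gset \<times> ('a, nat) gset) set"

definition gset_diff ::
    "('a, 'm) monoid_scheme \<Rightarrow> ('a, 'x) gset \<Rightarrow> ('a, 'y) gset \<Rightarrow> 'a burnside" where
  "gset_diff G X Y =
     {(X', Y'). finite_gset G X' \<and> finite_gset G Y' \<and>
        (\<exists>Z :: ('a, nat) gset. finite_gset G Z \<and>
           gset_iso G (gset_sum (gset_sum X Y') Z) (gset_sum (gset_sum X' Y) Z))}"

definition gset_class :: "('a, 'm) monoid_scheme \<Rightarrow> ('a, 'x) gset \<Rightarrow> 'a burnside" where
  "gset_class G X = gset_diff G X gset_empty"

definition burnside_ring :: "('a, 'm) monoid_scheme \<Rightarrow> 'a burnside ring" where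
  "burnside_ring G =
     \<lparr>carrier = {gset_diff G X Y | (X :: ('a, nat) gset) (Y :: ('a, nat) gset).
                   finite_gset G X \<and> finite_gset G Y},
      mult = (\<lambda>A B. \<Union>(X, Y)\<in>A. \<Union>(X', Y')\<in>B.
                gset_diff G (gset_sum (gset_prod X X') (gset_prod Y Y'))
                            (gset_sum (gset_prod X Y') (gset_prod Y X'))),
      one = gset_class G gset_point,
      zero = gset_class G gset_empty,
      add = (\<lambda>A B. \<Union>(X, Y)\<in>A. \<Union>(X', Y')\<in>B.
               gset_diff G (gset_sum X X') (gset_sum Y Y'))\<rparr>"

definition normal_burnside_ring :: "('a, 'm) monoid_scheme \<Rightarrow> 'a burnside ring" where
  "normal_burnside_ring G =
     (burnside_ring G)
       \<lparr>carrier :=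
          {\<Oplus>\<^bsub>burnside_ring G\<^esub>N\<in>{N. N \<lhd> G}.
             [a N] \<cdot>\<^bsub>burnside_ring G\<^esub> gset_class G (gset_cosets G N) | a :: 'a set \<Rightarrow> int. True}\<rparr>"


section \<open>Core coefficients\<close>

definition conj_class :: "('a, 'm) monoid_scheme \<Rightarrow> 'a set \<Rightarrow> 'a set set" where
  "conj_class G H = {g <#\<^bsub>G\<^esub> H #>\<^bsub>G\<^esub> inv\<^bsub>G\<^esub> g | g. g \<in> carrier G}"

definition normal_core :: "('a, 'm) monoid_scheme \<Rightarrow> 'a set \<Rightarrow> 'a set" where
  "normal_core G H = (\<Inter>g\<in>carrier G. g <#\<^bsub>G\<^esub> H #>\<^bsub>G\<^esub> inv\<^bsub>G\<^esub> g)"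

text \<open>
  The unique integers \<open>a\<^sub>C\<close>, indexed by the conjugacy classes \<open>C = (H)\<close> of subgroups, with
  \<open>x = \<Sum>\<^sub>C a\<^sub>C [G/H]\<close>; the class \<open>[G/H]\<close> does not depend on the representative \<open>H\<close> of \<open>C\<close>.
\<close>

definition burnside_coeffs :: "('a, 'm) monoid_scheme \<Rightarrow> 'a burnside \<Rightarrow> 'a set set \<Rightarrow> int" where
  "burnside_coeffs G x =
     (THE a. a \<in> extensional (conj_class G ` {H. subgroup H G}) \<and>
        x = (\<Oplus>\<^bsub>burnside_ring G\<^esub>C\<in>conj_class G ` {H. subgroup H G}.
               [a C] \<cdot>\<^bsub>burnside_ring G\<^esub> gset_class G (gset_cosets G (SOME H. H \<in> C))))"

definition core_coeff :: "('a, 'm) monoid_scheme \<Rightarrow> 'a set \<Rightarrow> 'a burnside \<Rightarrow> int" where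
  "core_coeff G N x =
     (\<Sum>C\<in>conj_class G ` {H. subgroup H G \<and> normal_core G H = N}. burnside_coeffs G x C)"


section \<open>Elementary abelian 2-groups\<close>

definition elementary_abelian_2_group :: "('a, 'm) monoid_scheme \<Rightarrow> bool" where
  "elementary_abelian_2_group Q \<longleftrightarrow>
     comm_group Q \<and> (\<forall>x\<in>carrier Q. x [^]\<^bsub>Q\<^esub> (2::nat) = \<one>\<^bsub>Q\<^esub>)"

end

(*
  A virtual G-set is determined by its marks |X^H|.  An element sum_N a_N [G/N] of the normal
  partial Burnside ring has mark f(H) = sum_{N >= H} a_N [G:N] at H, and it is a unit iff all
  its marks are 1 or -1.

  Suppose a_N is nonzero for such a unit, G/N is not elementary abelian, and N is maximal with
  this property.  If M is the smallest normal subgroup above N with G/M an elementary abelian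
  2-group, then every L properly above N with a_L nonzero lies above M, so
  f(N) - f(M) = a_N [G:N].  The left side is 0, 2 or -2, hence [G:N] divides 2, a contradiction.

  Conversely, given an elementary abelian quotient G/N and x not in N, take a unit supported above
  M = <N, x> with nonzero coefficient at M, and multiply it by 1 - [G/K], where K is an index 2
  subgroup containing N but not x.  Since M \<inter> K = N, this produces a nonzero coefficient at N.
*)
theory Submission
  imports Defs "HOL-Algebra.Elementary_Groups" "HOL-Algebra.Multiplicative_Group"
begin

section \<open>Fixed points determine a finite \<open>G\<close>-set\<close>

text \<open>The ring operations are unions over all representatives of two classes, and equality of
  classes hides an auxiliary summand \<open>Z\<close>. Burnside's theorem removes both obstacles:
  finite G-sets with equal fixed point counts at all subgroups are isomorphic, so an element of the
  ring is known once its integer marks are known. Well-definedness, ring laws and uniqueness of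
  coefficients then become identities between integers, and no isomorphism of sums or products is
  written down. In the converse direction, multiplication by 1 - [G/K] flips the sign of the marks
  at subgroups of \<open>K\<close> and keeps all others, so a unit stays a unit. The danger is
  cancellation at \<open>N\<close>. It is excluded because every \<open>L\<close> in the support
  contains \<open>x\<close>, which lies outside \<open>K\<close>: such an \<open>L\<close> is
  recovered from its trace on \<open>K\<close> as the union of \<open>L \<inter> K\<close> and its
  translate by \<open>x\<close>, so only \<open>M\<close> can have trace \<open>N\<close>.\<close>

lemma (in group) group_actionI:
  assumes ext: "\<And>g. g \<in> carrier G \<Longrightarrow> \<phi> g \<in> extensional E"
    and closed: "\<And>g x. g \<in> carrier G \<Longrightarrow> x \<in> E \<Longrightarrow> \<phi> g x \<in> E"
    and one: "\<And>x. x \<in> E \<Longrightarrow> \<phi> \<one> x = x"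
    and mult: "\<And>g h x. g \<in> carrier G \<Longrightarrow> h \<in> carrier G \<Longrightarrow> x \<in> E \<Longrightarrow> \<phi> (g \<otimes> h) x = \<phi> g (\<phi> h x)"
  shows "group_action G E \<phi>"
proof -
  have "\<phi> g \<in> Bij E" if g: "g \<in> carrier G" for g
  proof -
    \<comment> \<open>The action of \<open>inv g\<close> is a two-sided inverse map, so bijectivity
      follows from the unit and multiplication laws.\<close>
    have "bij_betw (\<phi> g) E E"
    proof (rule bij_betw_byWitness[where f' = "\<phi> (inv g)"])
      show "\<forall>x\<in>E. \<phi> (inv g) (\<phi> g x) = x"
        using g one by (simp flip: mult)
      show "\<forall>x\<in>E. \<phi> g (\<phi> (inv g) x) = x"
        using g one by (simp flip: mult)
    qed (use g closed in auto)
    then show ?thesis using ext[OF g] by (simp add: Bij_def)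
  qed
  moreover have "\<phi> (g \<otimes> h) = compose E (\<phi> g) (\<phi> h)" if "g \<in> carrier G" "h \<in> carrier G" for g h
    using that by (intro extensionalityI[of _ E]) (auto simp: ext mult compose_eq)
  ultimately have "\<phi> \<in> hom G (BijGroup E)"
    by (auto simp: hom_def BijGroup_def)
  then show ?thesis
    by (simp add: group_action_def group_hom_def group_hom_axioms_def group_BijGroup is_group)
qed

lemma finite_gset_action:
  assumes "finite_gset G X" "g \<in> carrier G" "x \<in> fst X"
  shows "snd X g x \<in> fst X"
  using assms group_action.element_image by (fastforce simp: finite_gset_def)

lemma finite_gset_one:
  assumes "finite_gset G X" "x \<in> fst X"
  shows "snd X \<one>\<^bsub>G\<^esub> x = x"
  using assms group_action.id_eq_one[of G "fst X" "snd X"]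
  by (metis finite_gset_def restrict_apply')

lemma finite_gset_mult:
  assumes "finite_gset G X" "g \<in> carrier G" "h \<in> carrier G" "x \<in> fst X"
  shows "snd X (g \<otimes>\<^bsub>G\<^esub> h) x = snd X g (snd X h x)"
  using assms by (simp add: finite_gset_def group_action.composition_rule[of G "fst X"])

lemma (in group) finite_gset_inv:
  assumes "finite_gset G X" "g \<in> carrier G" "x \<in> fst X"
  shows "snd X (inv g) (snd X g x) = x" "snd X g (snd X (inv g) x) = x"
  using assms by (simp_all flip: finite_gset_mult add: finite_gset_one)

lemma (in group) finite_gset_sum:
  assumes "finite_gset G X" "finite_gset G Y"
  shows "finite_gset G (gset_sum X Y)"
proof -
  have "group_action G (fst X <+> fst Y) (\<lambda>g. restrict (map_sum (snd X g) (snd Y g)) (fst X <+> fst Y))"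
    by (rule group_actionI)
      (auto simp: finite_gset_action[OF assms(1)] finite_gset_action[OF assms(2)]
         finite_gset_one[OF assms(1)] finite_gset_one[OF assms(2)]
         finite_gset_mult[OF assms(1)] finite_gset_mult[OF assms(2)])
  then show ?thesis using assms by (auto simp: finite_gset_def gset_sum_def)
qed

lemma (in group) finite_gset_prod:
  assumes "finite_gset G X" "finite_gset G Y"
  shows "finite_gset G (gset_prod X Y)"
proof -
  have "group_action G (fst X \<times> fst Y) (\<lambda>g. restrict (map_prod (snd X g) (snd Y g)) (fst X \<times> fst Y))"
    by (rule group_actionI)
      (auto simp: finite_gset_action[OF assms(1)] finite_gset_action[OF assms(2)]
         finite_gset_one[OF assms(1)] finite_gset_one[OF assms(2)]
         finite_gset_mult[OF assms(1)] finite_gset_mult[OF assms(2)])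
  then show ?thesis using assms by (auto simp: finite_gset_def gset_prod_def)
qed

lemma (in group) finite_gset_empty: "finite_gset G gset_empty"
  unfolding finite_gset_def gset_empty_def by (auto intro!: group_actionI)

lemma (in group) finite_gset_point: "finite_gset G gset_point"
  unfolding finite_gset_def gset_point_def by (auto intro!: group_actionI)

definition subgset :: "('a, 'x) gset \<Rightarrow> 'x set \<Rightarrow> ('a, 'x) gset" where
  "subgset X A = (A, \<lambda>g. restrict (snd X g) A)"

lemma (in group) finite_gset_subgset:
  assumes X: "finite_gset G X" and A: "A \<subseteq> fst X"
    and inv: "\<And>g x. g \<in> carrier G \<Longrightarrow> x \<in> A \<Longrightarrow> snd X g x \<in> A"
  shows "finite_gset G (subgset X A)"
proof -
  have "group_action G A (\<lambda>g. restrict (snd X g) A)"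
    using A inv by (intro group_actionI) (auto simp: finite_gset_one[OF X] finite_gset_mult[OF X] subsetD)
  then show ?thesis using X A by (auto simp: finite_gset_def subgset_def finite_subset)
qed

section \<open>Counting fixed points\<close>

definition fixed_points :: "('a, 'x) gset \<Rightarrow> 'a set \<Rightarrow> 'x set" where
  "fixed_points X H = {x \<in> fst X. \<forall>h\<in>H. snd X h x = x}"

lemma fixed_points_iff: "x \<in> fixed_points X H \<longleftrightarrow> x \<in> fst X \<and> (\<forall>h\<in>H. snd X h x = x)"
  by (simp add: fixed_points_def)

lemma finite_fixed_points: "finite_gset G X \<Longrightarrow> finite (fixed_points X H)"
  by (simp add: fixed_points_def finite_gset_def)

lemma gset_iso_card_fixed_points:
  assumes "gset_iso G X Y" "finite_gset G X" "finite_gset G Y" "H \<subseteq> carrier G"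
  shows "card (fixed_points X H) = card (fixed_points Y H)"
proof -
  obtain f where f: "bij_betw f (fst X) (fst Y)"
    "\<And>g x. g \<in> carrier G \<Longrightarrow> x \<in> fst X \<Longrightarrow> f (snd X g x) = snd Y g (f x)"
    using assms(1) by (auto simp: gset_iso_def)
  have sub: "fixed_points X H \<subseteq> fst X" "fixed_points Y H \<subseteq> fst Y"
    by (auto simp: fixed_points_def)
  have iff: "x \<in> fixed_points X H \<longleftrightarrow> f x \<in> fixed_points Y H" if x: "x \<in> fst X" for x
  proof -
    have "snd X h x = x \<longleftrightarrow> snd Y h (f x) = f x" if "h \<in> H" for h
    proof -
      have h: "h \<in> carrier G" using that assms(4) by blast
      show ?thesis
        using f(2)[OF h x] bij_betw_imp_inj_on[OF f(1)] finite_gset_action[OF assms(2) h x] x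
        by (metis inj_on_eq_iff)
    qed
    then show ?thesis using f(1) x by (auto simp: fixed_points_iff bij_betw_apply)
  qed
  have "f ` fixed_points X H = fixed_points Y H"
  proof (intro equalityI subsetI)
    fix y assume y: "y \<in> fixed_points Y H"
    then have "y \<in> f ` fst X"
      using f(1) sub(2) by (auto simp: bij_betw_def)
    then show "y \<in> f ` fixed_points X H"
      using y iff by (elim imageE) simp
  next
    fix y assume "y \<in> f ` fixed_points X H"
    then obtain x where x: "x \<in> fixed_points X H" "y = f x" ..
    then show "y \<in> fixed_points Y H"
      using iff[OF subsetD[OF sub(1) x(1)]] by simp
  qed
  then have "bij_betw f (fixed_points X H) (fixed_points Y H)"
    by (rule bij_betw_subset[OF f(1) sub(1)])
  then show ?thesis by (rule bij_betw_same_card)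
qed

lemma card_fixed_points_sum:
  assumes "finite_gset G X" "finite_gset G Y"
  shows "card (fixed_points (gset_sum X Y) H) = card (fixed_points X H) + card (fixed_points Y H)"
proof -
  have "fixed_points (gset_sum X Y) H = fixed_points X H <+> fixed_points Y H"
    by (auto simp: fixed_points_def gset_sum_def)
  then show ?thesis using assms by (simp add: card_Plus finite_fixed_points)
qed

lemma card_fixed_points_prod:
  "card (fixed_points (gset_prod X Y) H) = card (fixed_points X H) * card (fixed_points Y H)"
proof -
  have "fixed_points (gset_prod X Y) H = fixed_points X H \<times> fixed_points Y H"
    by (auto simp: fixed_points_def gset_prod_def)
  then show ?thesis by (simp add: card_cartesian_product)
qed

lemma card_fixed_points_empty: "card (fixed_points gset_empty H) = 0"
  by (simp add: fixed_points_def gset_empty_def)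

lemma card_fixed_points_point: "card (fixed_points gset_point H) = 1"
proof -
  have "fixed_points gset_point H = {0}"
    by (auto simp: fixed_points_def gset_point_def)
  then show ?thesis by simp
qed

section \<open>Splitting G-sets along orbits\<close>

lemma fixed_points_subgset:
  "A \<subseteq> fst X \<Longrightarrow> fixed_points (subgset X A) H = fixed_points X H \<inter> A"
  by (auto simp: fixed_points_def subgset_def)

text \<open>Invariance of \<open>A\<close> and of its complement ensures that \<open>x\<close> and
  \<open>snd X g x\<close> are sent by the same one of the two maps being glued. On the
  \<open>Y\<close> side the restricted action agrees with \<open>snd Y g\<close> because the images
  already lie in the piece.\<close>

lemma gset_iso_decompose:
  assumes A: "A \<subseteq> fst X" and B: "B \<subseteq> fst Y"
    and invA: "\<And>g x. g \<in> carrier G \<Longrightarrow> x \<in> A \<Longrightarrow> snd X g x \<in> A"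
    and invA': "\<And>g x. g \<in> carrier G \<Longrightarrow> x \<in> fst X - A \<Longrightarrow> snd X g x \<in> fst X - A"
    and iso: "gset_iso G (subgset X A) (subgset Y B)"
      "gset_iso G (subgset X (fst X - A)) (subgset Y (fst Y - B))"
  shows "gset_iso G X Y"
proof -
  obtain f1 where f1: "bij_betw f1 A B"
    "\<And>g x. g \<in> carrier G \<Longrightarrow> x \<in> A \<Longrightarrow> f1 (snd X g x) = snd Y g (f1 x)"
    using iso(1) bij_betw_apply by (fastforce simp: gset_iso_def subgset_def)
  obtain f2 where f2: "bij_betw f2 (fst X - A) (fst Y - B)"
    "\<And>g x. g \<in> carrier G \<Longrightarrow> x \<in> fst X - A \<Longrightarrow> f2 (snd X g x) = snd Y g (f2 x)"
    using iso(2) bij_betw_apply by (fastforce simp: gset_iso_def subgset_def)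
  define f where "f = (\<lambda>x. if x \<in> A then f1 x else f2 x)"
  have "bij_betw f (A \<union> (fst X - A)) (B \<union> (fst Y - B))"
    unfolding f_def using f1(1) f2(1) by (intro bij_betw_disjoint_Un) auto
  then have "bij_betw f (fst X) (fst Y)"
    using A B by (simp add: Un_absorb1)
  moreover have "f (snd X g x) = snd Y g (f x)" if "g \<in> carrier G" "x \<in> fst X" for g x
    using that f1(2) f2(2) invA invA' by (cases "x \<in> A") (auto simp: f_def)
  ultimately show ?thesis by (auto simp: gset_iso_def)
qed

text \<open>Both orbits look like \<open>G\<close> modulo the common stabilizer: two group elements
  agree on \<open>x\<close> exactly when they agree on \<open>y\<close>, so sending g x to g y is
  well defined, injective and equivariant.\<close>

lemma (in group) orbit_iso:
  assumes X: "finite_gset G X" and Y: "finite_gset G Y" and x: "x \<in> fst X" and y: "y \<in> fst Y"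
    and stab: "stabilizer G (snd X) x = stabilizer G (snd Y) y"
  shows "gset_iso G (subgset X (orbit G (snd X) x)) (subgset Y (orbit G (snd Y) y))"
proof -
  have eq_iff: "snd X g x = snd X h x \<longleftrightarrow> snd Y g y = snd Y h y"
    if g: "g \<in> carrier G" and h: "h \<in> carrier G" for g h
  proof -
    have "snd Z g z = snd Z h z \<longleftrightarrow> inv h \<otimes> g \<in> stabilizer G (snd Z) z"
      if Z: "finite_gset G Z" "z \<in> fst Z" for Z :: "('a, 'z) gset" and z
    proof -
      have "inv h \<otimes> g \<in> stabilizer G (snd Z) z \<longleftrightarrow> snd Z (inv h) (snd Z g z) = z"
        using g h Z by (simp add: stabilizer_def finite_gset_mult)
      also have "\<dots> \<longleftrightarrow> snd Z g z = snd Z h z"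
        using finite_gset_inv[OF Z(1)] finite_gset_action[OF Z(1)] Z(2) g h by metis
      finally show ?thesis by simp
    qed
    from this[OF X x] this[OF Y y] stab show ?thesis by simp
  qed
  \<comment> \<open>\<open>SOME\<close> picks one of many elements carrying \<open>x\<close> to
    \<open>z\<close>; by \<open>eq_iff\<close> all of them have the same effect on
    \<open>y\<close>.\<close>
  define f where "f = (\<lambda>z. snd Y (SOME g. g \<in> carrier G \<and> snd X g x = z) y)"
  have f: "f (snd X g x) = snd Y g y" if "g \<in> carrier G" for g
    unfolding f_def
    by (rule someI2[of _ g]) (use that eq_iff in auto)
  have "bij_betw f (orbit G (snd X) x) (orbit G (snd Y) y)"
    unfolding bij_betw_def inj_on_def
  proof (intro conjI ballI impI)
    show "f ` orbit G (snd X) x = orbit G (snd Y) y"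
      by (force simp: orbit_def f image_iff)
  qed (auto simp: orbit_def f eq_iff)
  moreover have "f (snd X g z) = snd Y g (f z)" if "g \<in> carrier G" "z \<in> orbit G (snd X) x" for g z
    using that by (auto simp: orbit_def f x y simp flip: finite_gset_mult[OF X] finite_gset_mult[OF Y])
  moreover have "snd Z g w \<in> orbit G (snd Z) z" 
    if "finite_gset G Z" "z \<in> fst Z" "g \<in> carrier G" "w \<in> orbit G (snd Z) z" for Z :: "('a, 'z) gset" and w z g
    using that by (auto simp: orbit_def simp flip: finite_gset_mult)
  ultimately show ?thesis
    unfolding gset_iso_def subgset_def using X Y x y
    by (intro exI[of _ f]) (auto simp: bij_betw_apply)
qed

lemma (in group) orbit_invariant:
  assumes X: "finite_gset G X" and x: "x \<in> fst X" and g: "g \<in> carrier G"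
  shows "orbit G (snd X) x \<subseteq> fst X"
    and "z \<in> orbit G (snd X) x \<Longrightarrow> snd X g z \<in> orbit G (snd X) x"
    and "z \<in> fst X - orbit G (snd X) x \<Longrightarrow> snd X g z \<in> fst X - orbit G (snd X) x"
proof -
  show sub: "orbit G (snd X) x \<subseteq> fst X"
    using finite_gset_action[OF X] x by (auto simp: orbit_def)
  have inv: "snd X h z \<in> orbit G (snd X) x" if "h \<in> carrier G" "z \<in> orbit G (snd X) x" for h z
    using that x by (auto simp: orbit_def simp flip: finite_gset_mult[OF X])
  then show "z \<in> orbit G (snd X) x \<Longrightarrow> snd X g z \<in> orbit G (snd X) x"
    using g by simp
  assume z: "z \<in> fst X - orbit G (snd X) x"
  then have "snd X (inv g) (snd X g z) = z"
    using finite_gset_inv[OF X g] by simp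
  then have "snd X g z \<notin> orbit G (snd X) x"
    using inv[of "inv g" "snd X g z"] g z by auto
  then show "snd X g z \<in> fst X - orbit G (snd X) x"
    using finite_gset_action[OF X g] z by simp
qed

locale finite_group = group +
  assumes finite_carrier: "finite (carrier G)"
begin

lemma finite_subgroup: "subgroup H G \<Longrightarrow> finite H"
  using finite_carrier finite_subset subgroup.subset by blast

lemma stabilizer_subgroup: 
  assumes "finite_gset G X" "x \<in> fst X"
  shows "subgroup (stabilizer G (snd X) x) G"
  using assms group_action.stabilizer_subgroup by (auto simp: finite_gset_def)

text \<open>
  Burnside's theorem.  A point of \<open>X\<close> whose stabilizer has maximal order has a partner in
  \<open>Y\<close> with the same stabilizer; their orbits are isomorphic and can be split off.
\<close>
theorem gset_iso_if_fixed_points: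
  assumes "finite_gset G X" "finite_gset G Y"
    and "\<And>H. subgroup H G \<Longrightarrow> card (fixed_points X H) = card (fixed_points Y H)"
  shows "gset_iso G X Y"
  using assms
proof (induction "card (fst X)" arbitrary: X Y rule: less_induct)
  case less
  note X = less.prems(1) and Y = less.prems(2) and marks = less.prems(3)
  have finX: "finite (fst X)" and finY: "finite (fst Y)"
    using X Y by (auto simp: finite_gset_def)
  show ?case
  proof (cases "fst X = {}")
    case True
    have "fixed_points X {\<one>} = fst X" "fixed_points Y {\<one>} = fst Y"
      using finite_gset_one[OF X] finite_gset_one[OF Y] by (auto simp: fixed_points_def)
    then have "fst Y = {}"
      using marks[OF triv_subgroup] True finY by simp
    then show ?thesis using True by (simp add: gset_iso_def bij_betw_def)
  next
    case False
    let ?S = "\<lambda>x. stabilizer G (snd X) x"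
    have "Max ((\<lambda>x. card (?S x)) ` fst X) \<in> (\<lambda>x. card (?S x)) ` fst X"
      using False finX by (intro Max_in) auto
    then obtain x where x: "x \<in> fst X" and "Max ((\<lambda>x. card (?S x)) ` fst X) = card (?S x)"
      by auto
    then have max: "card (?S z) \<le> card (?S x)" if "z \<in> fst X" for z
      using that finX by (metis Max_ge finite_imageI imageI)
    have sub: "subgroup (?S x) G" by (rule stabilizer_subgroup[OF X x])
    have "x \<in> fixed_points X (?S x)"
      using x by (auto simp: fixed_points_def stabilizer_def)
    then have "card (fixed_points Y (?S x)) \<noteq> 0"
      using marks[OF sub] finite_fixed_points[OF X, of "?S x"] by (metis card_0_eq empty_iff)
    then obtain y where y: "y \<in> fst Y" and Sy: "?S x \<subseteq> stabilizer G (snd Y) y"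
      by (auto simp: fixed_points_def stabilizer_def card_eq_0_iff)
    let ?T = "stabilizer G (snd Y) y"
    have subT: "subgroup ?T G" by (rule stabilizer_subgroup[OF Y y])
    \<comment> \<open>Now the count is read backwards: \<open>?T\<close> fixes some \<open>z\<close>
      in \<open>X\<close>, so its order is at most that of the stabilizer of \<open>z\<close>, hence
      at most that of \<open>?S x\<close>. As \<open>?S x\<close> is contained in \<open>?T\<close>,
      the two coincide.\<close>
    have "y \<in> fixed_points Y ?T"
      using y by (auto simp: fixed_points_def stabilizer_def)
    then have "card (fixed_points X ?T) \<noteq> 0"
      using marks[OF subT] finite_fixed_points[OF Y, of ?T] by (metis card_0_eq empty_iff)
    then obtain z where z: "z \<in> fst X" "?T \<subseteq> ?S z"
      by (auto simp: fixed_points_def stabilizer_def card_eq_0_iff)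
    have "card ?T \<le> card (?S x)"
      using max[OF z(1)] card_mono[OF finite_subgroup[OF stabilizer_subgroup[OF X z(1)]] z(2)] by simp
    then have stab: "?S x = ?T"
      using Sy by (simp add: card_seteq finite_subgroup[OF subT])
    let ?A = "orbit G (snd X) x" and ?B = "orbit G (snd Y) y"
    note A = orbit_invariant[OF X x] and B = orbit_invariant[OF Y y]
    have AX: "?A \<subseteq> fst X" and BY: "?B \<subseteq> fst Y"
      using A(1) B(1) by blast+
    have iso: "gset_iso G (subgset X ?A) (subgset Y ?B)"
      by (rule orbit_iso[OF X Y x y stab])
    have card_split: "card (fixed_points Z H) =
        card (fixed_points (subgset Z D) H) + card (fixed_points (subgset Z (fst Z - D)) H)"
      if "finite_gset G Z" "D \<subseteq> fst Z" for Z :: "('a, 'z) gset" and D H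
    proof -
      have "fixed_points Z H = (fixed_points Z H \<inter> D) \<union> (fixed_points Z H \<inter> (fst Z - D))"
        by (auto simp: fixed_points_def)
      also have "card \<dots> = card (fixed_points Z H \<inter> D) + card (fixed_points Z H \<inter> (fst Z - D))"
        by (rule card_Un_disjoint) (use finite_fixed_points[OF that(1)] in auto)
      finally show ?thesis using that(2) by (simp add: fixed_points_subgset)
    qed
    have "gset_iso G (subgset X (fst X - ?A)) (subgset Y (fst Y - ?B))"
    proof (rule less.hyps)
      have "x \<in> ?A" using X x group_action.orbit_refl by (fastforce simp: finite_gset_def)
      then show "card (fst (subgset X (fst X - ?A))) < card (fst X)"
        using x finX by (auto simp: subgset_def intro!: psubset_card_mono)
      show "finite_gset G (subgset X (fst X - ?A))"
        by (rule finite_gset_subgset[OF X]) (use A in auto)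
      show "finite_gset G (subgset Y (fst Y - ?B))"
        by (rule finite_gset_subgset[OF Y]) (use B in auto)
      fix H assume H: "subgroup H G"
      have "card (fixed_points (subgset X ?A) H) = card (fixed_points (subgset Y ?B) H)"
        by (rule gset_iso_card_fixed_points[OF iso finite_gset_subgset[OF X] finite_gset_subgset[OF Y]])
          (use A B AX BY subgroup.subset[OF H] in auto)
      then show "card (fixed_points (subgset X (fst X - ?A)) H) =
          card (fixed_points (subgset Y (fst Y - ?B)) H)"
        using card_split[OF X AX, of H] card_split[OF Y BY, of H] marks[OF H] by simp
    qed
    then show ?thesis
      using A B AX BY iso by (intro gset_iso_decompose[of ?A X ?B Y]) auto
  qed
qed

end


section \<open>Marks on the Burnside ring\<close>

definition mark :: "('a, 'x) gset \<Rightarrow> 'a set \<Rightarrow> int" where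
  "mark X H = int (card (fixed_points X H))"

lemma (in group) mark_sum:
  "finite_gset G X \<Longrightarrow> finite_gset G Y \<Longrightarrow> mark (gset_sum X Y) H = mark X H + mark Y H"
  by (simp add: mark_def card_fixed_points_sum)

lemma mark_prod: "mark (gset_prod X Y) H = mark X H * mark Y H"
  by (simp add: mark_def card_fixed_points_prod)

lemma mark_empty: "mark gset_empty H = 0"
  by (simp add: mark_def card_fixed_points_empty)

lemma mark_point: "mark gset_point H = 1"
  by (simp add: mark_def card_fixed_points_point)

text \<open>The value is read off an arbitrary member of the class. At subgroups the choice does not
  matter, by \<open>burnside_mark_gset_diff\<close>.\<close>

definition burnside_mark :: "'a burnside \<Rightarrow> 'a set \<Rightarrow> int" where
  "burnside_mark A H = (case (SOME p. p \<in> A) of (X, Y) \<Rightarrow> mark X H - mark Y H)"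

context finite_group
begin

lemma gset_iso_iff_mark:
  assumes "finite_gset G X" "finite_gset G Y"
  shows "gset_iso G X Y \<longleftrightarrow> (\<forall>H. subgroup H G \<longrightarrow> mark X H = mark Y H)"
  using gset_iso_if_fixed_points[OF assms] gset_iso_card_fixed_points[OF _ assms]
  by (auto simp: mark_def subgroup.subset)

text \<open>The members of a class live on \<open>nat\<close>, while sums, products and coset spaces
  live on other types. An injection of the finite underlying set into \<open>nat\<close> transports
  the action back.\<close>

lemma gset_on_nat:
  fixes X :: "('a, 'x) gset"
  assumes X: "finite_gset G X"
  obtains Y :: "('a, nat) gset" where "finite_gset G Y" "gset_iso G X Y"
proof -
  obtain f :: "'x \<Rightarrow> nat" where f: "inj_on f (fst X)"
    using X finite_imp_inj_to_nat_seg by (fastforce simp: finite_gset_def)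
  let ?E = "f ` fst X"
  define Y where "Y = (?E, \<lambda>g. \<lambda>n\<in>?E. f (snd X g (inv_into (fst X) f n)))"
  have "group_action G ?E (\<lambda>g. \<lambda>n\<in>?E. f (snd X g (inv_into (fst X) f n)))"
    by (rule group_actionI)
      (auto simp: f finite_gset_action[OF X] finite_gset_one[OF X] finite_gset_mult[OF X]
        inj_on_eq_iff[OF f])
  then have "finite_gset G Y"
    using X by (simp add: finite_gset_def Y_def)
  moreover have "gset_iso G X Y"
    unfolding gset_iso_def Y_def using f by (intro exI[of _ f]) (auto simp: bij_betw_def)
  ultimately show thesis by (rule that)
qed

text \<open>Isomorphism is equality of marks, marks are additive, and integers cancel; so whether
  \<open>Z\<close> works does not depend on \<open>Z\<close>, and \<open>gset_empty\<close> serves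
  as witness.\<close>

lemma gset_diff_eq:
  assumes X: "finite_gset G X" and Y: "finite_gset G Y"
  shows "gset_diff G X Y = {(X', Y'). finite_gset G X' \<and> finite_gset G Y' \<and>
           (\<forall>H. subgroup H G \<longrightarrow> mark X' H - mark Y' H = mark X H - mark Y H)}"
proof -
  have "(\<exists>Z :: ('a, nat) gset. finite_gset G Z \<and>
           gset_iso G (gset_sum (gset_sum X Y') Z) (gset_sum (gset_sum X' Y) Z)) \<longleftrightarrow>
        (\<forall>H. subgroup H G \<longrightarrow> mark X' H - mark Y' H = mark X H - mark Y H)"
    if X': "finite_gset G X'" and Y': "finite_gset G Y'" for X' Y' :: "('a, nat) gset"
  proof -
    have "gset_iso G (gset_sum (gset_sum X Y') Z) (gset_sum (gset_sum X' Y) Z) \<longleftrightarrow>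
        (\<forall>H. subgroup H G \<longrightarrow> mark X' H - mark Y' H = mark X H - mark Y H)"
      if Z: "finite_gset G Z" for Z :: "('a, nat) gset"
    proof -
      have "gset_iso G (gset_sum (gset_sum X Y') Z) (gset_sum (gset_sum X' Y) Z) \<longleftrightarrow>
          (\<forall>H. subgroup H G \<longrightarrow> mark X H + mark Y' H + mark Z H = mark X' H + mark Y H + mark Z H)"
        using X Y X' Y' Z by (simp add: gset_iso_iff_mark finite_gset_sum mark_sum)
      moreover have "mark X H + mark Y' H + mark Z H = mark X' H + mark Y H + mark Z H \<longleftrightarrow>
          mark X' H - mark Y' H = mark X H - mark Y H" for H
        by linarith
      ultimately show ?thesis by simp
    qed
    then show ?thesis using finite_gset_empty by blast
  qed
  then show ?thesis
    by (simp add: gset_diff_def cong: conj_cong del: split_paired_All split_paired_Ex)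
qed

text \<open>Serves two purposes: a class is nonempty, so that choices from it and unions over it
  behave, and a difference formed on arbitrary types lies in the carrier.\<close>

lemma gset_diff_representative:
  assumes X: "finite_gset G X" and Y: "finite_gset G Y"
  obtains X' Y' :: "('a, nat) gset"
  where "finite_gset G X'" "finite_gset G Y'" "(X', Y') \<in> gset_diff G X Y"
    "gset_diff G X Y = gset_diff G X' Y'"
proof -
  obtain X' :: "('a, nat) gset" where X': "finite_gset G X'" "gset_iso G X X'"
    by (rule gset_on_nat[OF X])
  obtain Y' :: "('a, nat) gset" where Y': "finite_gset G Y'" "gset_iso G Y Y'"
    by (rule gset_on_nat[OF Y])
  have "mark X' H - mark Y' H = mark X H - mark Y H" if "subgroup H G" for H
    using that X X' Y Y' by (simp add: gset_iso_iff_mark)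
  then show thesis
    using X Y X'(1) Y'(1) by (intro that[of X' Y']) (auto simp: gset_diff_eq)
qed

lemma burnside_mark_gset_diff:
  assumes X: "finite_gset G X" and Y: "finite_gset G Y" and H: "subgroup H G"
  shows "burnside_mark (gset_diff G X Y) H = mark X H - mark Y H"
proof -
  obtain p where "p \<in> gset_diff G X Y"
    using gset_diff_representative[OF X Y] by blast
  then have "(SOME p. p \<in> gset_diff G X Y) \<in> gset_diff G X Y"
    by (rule someI)
  then show ?thesis
    using H by (auto simp: burnside_mark_def gset_diff_eq[OF X Y])
qed

section \<open>Ring operations expressed by marks\<close>

abbreviation R where "R \<equiv> burnside_ring G"

lemma burnside_carrierE:
  assumes "A \<in> carrier R"
  obtains X Y :: "('a, nat) gset"
  where "finite_gset G X" "finite_gset G Y" "A = gset_diff G X Y"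
  using assms unfolding burnside_ring_def
  by (simp del: split_paired_Ex) blast

lemma gset_diff_carrier:
  assumes "finite_gset G X" "finite_gset G Y"
  shows "gset_diff G X Y \<in> carrier R"
proof -
  obtain X' Y' :: "('a, nat) gset" where "finite_gset G X'" "finite_gset G Y'"
    "gset_diff G X Y = gset_diff G X' Y'"
    by (rule gset_diff_representative[OF assms])
  then show ?thesis
    unfolding burnside_ring_def by (simp del: split_paired_Ex) blast
qed

lemma burnside_eqI:
  assumes "A \<in> carrier R" "B \<in> carrier R"
    and "\<And>H. subgroup H G \<Longrightarrow> burnside_mark A H = burnside_mark B H"
  shows "A = B"
proof -
  obtain X Y :: "('a, nat) gset" where A: "finite_gset G X" "finite_gset G Y" "A = gset_diff G X Y"
    by (rule burnside_carrierE[OF assms(1)])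
  obtain X' Y' :: "('a, nat) gset" where B: "finite_gset G X'" "finite_gset G Y'" "B = gset_diff G X' Y'"
    by (rule burnside_carrierE[OF assms(2)])
  have "mark X H - mark Y H = mark X' H - mark Y' H" if "subgroup H G" for H
    using assms(3)[OF that] A B that by (simp add: burnside_mark_gset_diff)
  then show ?thesis using A B by (simp add: gset_diff_eq)
qed

text \<open>All sets in the union that defines the sum are the same class, since the marks of the
  result depend only on the mark differences of the summands. Nonemptiness of both classes then
  collapses the union.\<close>

lemma burnside_add_gset_diff:
  assumes "finite_gset G X" "finite_gset G Y" "finite_gset G X'" "finite_gset G Y'"
  shows "gset_diff G X Y \<oplus>\<^bsub>R\<^esub> gset_diff G X' Y' = gset_diff G (gset_sum X X') (gset_sum Y Y')"
proof -
  obtain p where p: "p \<in> gset_diff G X Y"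
    using gset_diff_representative[OF assms(1,2)] by blast
  obtain q where q: "q \<in> gset_diff G X' Y'"
    using gset_diff_representative[OF assms(3,4)] by blast
  have "gset_diff G (gset_sum U U') (gset_sum V V') = gset_diff G (gset_sum X X') (gset_sum Y Y')"
    if "(U, V) \<in> gset_diff G X Y" "(U', V') \<in> gset_diff G X' Y'" for U V U' V'
  proof -
    have fin: "finite_gset G U" "finite_gset G V" "finite_gset G U'" "finite_gset G V'"
      using that assms by (auto simp: gset_diff_eq)
    have "mark U H + mark U' H - (mark V H + mark V' H) = mark X H + mark X' H - (mark Y H + mark Y' H)"
      if H: "subgroup H G" for H
    proof -
      have "mark U H - mark V H = mark X H - mark Y H" "mark U' H - mark V' H = mark X' H - mark Y' H"
        using H that assms \<open>(U, V) \<in> _\<close> \<open>(U', V') \<in> _\<close> by (auto simp: gset_diff_eq)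
      then show ?thesis by linarith
    qed
    then show ?thesis
      using fin assms by (simp add: gset_diff_eq finite_gset_sum mark_sum)
  qed
  then have "(\<Union>(U, V)\<in>gset_diff G X Y. \<Union>(U', V')\<in>gset_diff G X' Y'.
        gset_diff G (gset_sum U U') (gset_sum V V')) =
      (\<Union>_\<in>gset_diff G X Y. \<Union>_\<in>gset_diff G X' Y'. gset_diff G (gset_sum X X') (gset_sum Y Y'))"
    by (intro SUP_cong refl) (simp add: split_beta)
  then show ?thesis using p q by (auto simp: burnside_ring_def)
qed

lemma burnside_mult_gset_diff:
  assumes "finite_gset G X" "finite_gset G Y" "finite_gset G X'" "finite_gset G Y'"
  shows "gset_diff G X Y \<otimes>\<^bsub>R\<^esub> gset_diff G X' Y' =
    gset_diff G (gset_sum (gset_prod X X') (gset_prod Y Y')) (gset_sum (gset_prod X Y') (gset_prod Y X'))"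
    (is "_ = ?D")
proof -
  obtain p where p: "p \<in> gset_diff G X Y"
    using gset_diff_representative[OF assms(1,2)] by blast
  obtain q where q: "q \<in> gset_diff G X' Y'"
    using gset_diff_representative[OF assms(3,4)] by blast
  have "gset_diff G (gset_sum (gset_prod U U') (gset_prod V V'))
      (gset_sum (gset_prod U V') (gset_prod V U')) = ?D"
    if UV: "(U, V) \<in> gset_diff G X Y" "(U', V') \<in> gset_diff G X' Y'" for U V U' V'
  proof -
    have fin: "finite_gset G U" "finite_gset G V" "finite_gset G U'" "finite_gset G V'"
      using that assms by (auto simp: gset_diff_eq)
    have "mark U H * mark U' H + mark V H * mark V' H - (mark U H * mark V' H + mark V H * mark U' H) =
        mark X H * mark X' H + mark Y H * mark Y' H - (mark X H * mark Y' H + mark Y H * mark X' H)"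
      if H: "subgroup H G" for H
    proof -
      have "mark U H - mark V H = mark X H - mark Y H" "mark U' H - mark V' H = mark X' H - mark Y' H"
        using H UV assms by (auto simp: gset_diff_eq)
      \<comment> \<open>The two sides of the goal are these products of differences, multiplied
        out.\<close>
      then have "(mark U H - mark V H) * (mark U' H - mark V' H) =
          (mark X H - mark Y H) * (mark X' H - mark Y' H)"
        by simp
      then show ?thesis by (simp add: algebra_simps)
    qed
    then show ?thesis
      using fin assms by (simp add: gset_diff_eq finite_gset_sum finite_gset_prod mark_sum mark_prod)
  qed
  then have "(\<Union>(U, V)\<in>gset_diff G X Y. \<Union>(U', V')\<in>gset_diff G X' Y'.
        gset_diff G (gset_sum (gset_prod U U') (gset_prod V V')) (gset_sum (gset_prod U V') (gset_prod V U'))) =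
      (\<Union>_\<in>gset_diff G X Y. \<Union>_\<in>gset_diff G X' Y'. ?D)"
    by (intro SUP_cong refl) (simp add: split_beta)
  then show ?thesis using p q by (auto simp: burnside_ring_def)
qed

lemma burnside_add:
  assumes "A \<in> carrier R" "B \<in> carrier R"
  shows "A \<oplus>\<^bsub>R\<^esub> B \<in> carrier R"
    and "subgroup H G \<Longrightarrow> burnside_mark (A \<oplus>\<^bsub>R\<^esub> B) H = burnside_mark A H + burnside_mark B H"
proof -
  obtain X Y :: "('a, nat) gset" where A: "finite_gset G X" "finite_gset G Y" "A = gset_diff G X Y"
    by (rule burnside_carrierE[OF assms(1)])
  obtain X' Y' :: "('a, nat) gset" where B: "finite_gset G X'" "finite_gset G Y'" "B = gset_diff G X' Y'"
    by (rule burnside_carrierE[OF assms(2)])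
  show "A \<oplus>\<^bsub>R\<^esub> B \<in> carrier R"
    using A B by (simp add: burnside_add_gset_diff gset_diff_carrier finite_gset_sum)
  show "subgroup H G \<Longrightarrow> burnside_mark (A \<oplus>\<^bsub>R\<^esub> B) H = burnside_mark A H + burnside_mark B H"
    using A B by (simp add: burnside_add_gset_diff burnside_mark_gset_diff finite_gset_sum mark_sum)
qed

lemma burnside_mult:
  assumes "A \<in> carrier R" "B \<in> carrier R"
  shows "A \<otimes>\<^bsub>R\<^esub> B \<in> carrier R"
    and "subgroup H G \<Longrightarrow> burnside_mark (A \<otimes>\<^bsub>R\<^esub> B) H = burnside_mark A H * burnside_mark B H"
proof -
  obtain X Y :: "('a, nat) gset" where A: "finite_gset G X" "finite_gset G Y" "A = gset_diff G X Y"
    by (rule burnside_carrierE[OF assms(1)])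
  obtain X' Y' :: "('a, nat) gset" where B: "finite_gset G X'" "finite_gset G Y'" "B = gset_diff G X' Y'"
    by (rule burnside_carrierE[OF assms(2)])
  show "A \<otimes>\<^bsub>R\<^esub> B \<in> carrier R"
    using A B by (simp add: burnside_mult_gset_diff gset_diff_carrier finite_gset_sum finite_gset_prod)
  show "subgroup H G \<Longrightarrow> burnside_mark (A \<otimes>\<^bsub>R\<^esub> B) H = burnside_mark A H * burnside_mark B H"
    using A B by (simp add: burnside_mult_gset_diff burnside_mark_gset_diff finite_gset_sum
        finite_gset_prod mark_sum mark_prod algebra_simps)
qed

lemma gset_class_carrier: "finite_gset G X \<Longrightarrow> gset_class G X \<in> carrier R"
  by (simp add: gset_class_def gset_diff_carrier finite_gset_empty)

lemma burnside_mark_gset_class: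
  "finite_gset G X \<Longrightarrow> subgroup H G \<Longrightarrow> burnside_mark (gset_class G X) H = mark X H"
  by (simp add: gset_class_def burnside_mark_gset_diff finite_gset_empty mark_empty)

lemma burnside_zero:
  "\<zero>\<^bsub>R\<^esub> \<in> carrier R" "subgroup H G \<Longrightarrow> burnside_mark \<zero>\<^bsub>R\<^esub> H = 0"
proof -
  have "\<zero>\<^bsub>R\<^esub> = gset_class G gset_empty" by (simp add: burnside_ring_def)
  then show "\<zero>\<^bsub>R\<^esub> \<in> carrier R" "subgroup H G \<Longrightarrow> burnside_mark \<zero>\<^bsub>R\<^esub> H = 0"
    by (simp_all add: gset_class_carrier burnside_mark_gset_class finite_gset_empty mark_empty)
qed

lemma burnside_one:
  "\<one>\<^bsub>R\<^esub> \<in> carrier R" "subgroup H G \<Longrightarrow> burnside_mark \<one>\<^bsub>R\<^esub> H = 1"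
proof -
  have "\<one>\<^bsub>R\<^esub> = gset_class G gset_point" by (simp add: burnside_ring_def)
  then show "\<one>\<^bsub>R\<^esub> \<in> carrier R" "subgroup H G \<Longrightarrow> burnside_mark \<one>\<^bsub>R\<^esub> H = 1"
    by (simp_all add: gset_class_carrier burnside_mark_gset_class finite_gset_point mark_point)
qed

text \<open>By \<open>burnside_eqI\<close> each law is checked on marks, where it is a law of the
  integers. Exchanging the two parts of a formal difference gives the additive inverse.\<close>

lemma abelian_group_burnside: "abelian_group R"
proof (rule abelian_groupI)
  fix A assume A: "A \<in> carrier R"
  then obtain X Y :: "('a, nat) gset" where XY: "finite_gset G X" "finite_gset G Y" "A = gset_diff G X Y"
    by (rule burnside_carrierE)
  let ?B = "gset_diff G Y X"
  have B: "?B \<in> carrier R" using XY by (simp add: gset_diff_carrier)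
  have "?B \<oplus>\<^bsub>R\<^esub> A = \<zero>\<^bsub>R\<^esub>"
    by (rule burnside_eqI)
      (use A B in \<open>simp_all add: burnside_add burnside_zero, simp add: XY burnside_mark_gset_diff\<close>)
  then show "\<exists>B\<in>carrier R. B \<oplus>\<^bsub>R\<^esub> A = \<zero>\<^bsub>R\<^esub>"
    using B by blast
qed (simp_all add: burnside_add burnside_zero burnside_eqI)

text \<open>Integer multiples in \<open>R\<close> are by definition powers in
  \<open>add_monoid R\<close>; this form lets \<open>hom_int_pow\<close> compute their marks,
  negative multiples included.\<close>

lemma group_hom_burnside_mark:
  assumes "subgroup H G"
  shows "group_hom (add_monoid R) integer_group (\<lambda>A. burnside_mark A H)"
proof -
  interpret R: abelian_group R by (rule abelian_group_burnside)
  show ?thesis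
    using assms R.a_group by (auto simp: group_hom_def group_hom_axioms_def hom_def burnside_add)
qed

lemma burnside_add_pow:
  fixes k :: int
  assumes "A \<in> carrier R"
  shows "[k] \<cdot>\<^bsub>R\<^esub> A \<in> carrier R"
    and "subgroup H G \<Longrightarrow> burnside_mark ([k] \<cdot>\<^bsub>R\<^esub> A) H = k * burnside_mark A H"
proof -
  interpret R: abelian_group R by (rule abelian_group_burnside)
  show "[k] \<cdot>\<^bsub>R\<^esub> A \<in> carrier R"
    using R.add.int_pow_closed[of A k] assms by simp
  show "burnside_mark ([k] \<cdot>\<^bsub>R\<^esub> A) H = k * burnside_mark A H" if "subgroup H G"
    using group_hom.hom_int_pow[OF group_hom_burnside_mark[OF that], of A k] assms
    by (simp add: add_pow_def)
qed

lemma burnside_finsum: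
  assumes "finite I" "\<And>i. i \<in> I \<Longrightarrow> A i \<in> carrier R"
  shows "finsum R A I \<in> carrier R"
    and "subgroup H G \<Longrightarrow> burnside_mark (finsum R A I) H = (\<Sum>i\<in>I. burnside_mark (A i) H)"
proof -
  interpret R: abelian_group R by (rule abelian_group_burnside)
  show "finsum R A I \<in> carrier R"
    using assms by (intro R.finsum_closed) auto
  show "burnside_mark (finsum R A I) H = (\<Sum>i\<in>I. burnside_mark (A i) H)" if "subgroup H G"
    using assms
  proof (induction I rule: finite_induct)
    case empty
    then show ?case using that by (simp add: burnside_zero)
  next
    case (insert i I)
    then have "A \<in> I \<rightarrow> carrier R" "A i \<in> carrier R" by auto
    then show ?case using insert that
      by (simp add: R.finsum_insert burnside_add)
  qed
qed

end


section \<open>Core coefficients and units in terms of marks\<close>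

context group
begin

lemma mult_inv_cancel:
  assumes "g \<in> carrier G" "h \<in> carrier G"
  shows "g \<otimes> (inv g \<otimes> h) = h" "inv g \<otimes> (g \<otimes> h) = h"
  using assms by (simp_all flip: m_assoc)

lemma l_coset_eq_iff:
  assumes K: "subgroup K G" and g: "g \<in> carrier G" and h: "h \<in> carrier G"
  shows "h <# K = g <# K \<longleftrightarrow> inv g \<otimes> h \<in> K"
proof
  assume "h <# K = g <# K"
  then have "h \<in> g <# K" using lcos_self[OF h K] by simp
  then show "inv g \<otimes> h \<in> K" using subgroup.lcos_module_imp[OF K is_group g] by simp
next
  assume "inv g \<otimes> h \<in> K"
  then have "h \<in> g <# K" using subgroup.lcos_module_rev[OF K is_group g h] by simp
  then show "h <# K = g <# K" using l_repr_independence[OF _ g K] by simp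
qed

lemma group_action_cosets:
  assumes K: "subgroup K G"
  shows "group_action G (fst (gset_cosets G K)) (snd (gset_cosets G K))"
  unfolding gset_cosets_def fst_conv snd_conv
  by (rule group_actionI)
    (auto simp: LCOSETS_def lcos_m_assoc subgroup.subset[OF K] m_assoc)

lemma fixed_points_cosets:
  assumes K: "subgroup K G" and H: "H \<subseteq> carrier G"
  shows "fixed_points (gset_cosets G K) H = {g <# K | g. g \<in> carrier G \<and> (\<forall>h\<in>H. inv g \<otimes> h \<otimes> g \<in> K)}"
proof -
  have "h <# (g <# K) = g <# K \<longleftrightarrow> inv g \<otimes> h \<otimes> g \<in> K" if g: "g \<in> carrier G" and "h \<in> H" for g h
  proof -
    have "h \<in> carrier G" using that H by blast
    then show ?thesis
      using g l_coset_eq_iff[OF K g, of "h \<otimes> g"]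
      by (simp add: lcos_m_assoc subgroup.subset[OF K] m_assoc)
  qed
  moreover have "fixed_points (gset_cosets G K) H =
      {g <# K | g. g \<in> carrier G \<and> (\<forall>h\<in>H. h <# (g <# K) = g <# K)}"
    unfolding fixed_points_def gset_cosets_def LCOSETS_def by auto
  ultimately show ?thesis by (simp cong: conj_cong)
qed

lemma conjugate_eq_image: "g <# H #> inv g = (\<lambda>h. g \<otimes> h \<otimes> inv g) ` H"
  by (auto simp: l_coset_def r_coset_def)

lemma conj_class_eq: "conj_class G H = {(\<lambda>h. g \<otimes> h \<otimes> inv g) ` H | g. g \<in> carrier G}"
  by (simp add: conj_class_def conjugate_eq_image)

lemma subgroup_conjugate:
  assumes "subgroup H G" "g \<in> carrier G"
  shows "subgroup ((\<lambda>h. g \<otimes> h \<otimes> inv g) ` H) G"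
  using subgroup_conjugation_is_surj2[OF assms(2,1)] by (simp add: conjugate_eq_image)

lemma card_conjugate:
  assumes "subgroup H G" "g \<in> carrier G"
  shows "card ((\<lambda>h. g \<otimes> h \<otimes> inv g) ` H) = card H"
  using conjugation_is_inj[OF assms(2)] subgroup.mem_carrier[OF assms(1)]
  by (intro card_image inj_onI) simp

lemma conj_class_self: "subgroup H G \<Longrightarrow> H \<in> conj_class G H"
  unfolding conj_class_eq using subgroup.subset by (force intro!: exI[of _ \<one>])

text \<open>Composing conjugations gives one inclusion for every subgroup and every conjugating
  element. Applied to the conjugate and \<open>inv g\<close>, which lead back to \<open>H\<close>,
  it gives the other.\<close>

lemma conj_class_conjugate:
  assumes H: "subgroup H G" and g: "g \<in> carrier G"
  shows "conj_class G ((\<lambda>h. g \<otimes> h \<otimes> inv g) ` H) = conj_class G H"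
proof -
  have comp: "(\<lambda>h. a \<otimes> h \<otimes> inv a) ` (\<lambda>h. b \<otimes> h \<otimes> inv b) ` K = (\<lambda>h. (a \<otimes> b) \<otimes> h \<otimes> inv (a \<otimes> b)) ` K"
    if "a \<in> carrier G" "b \<in> carrier G" "subgroup K G" for a b K
    using that subgroup.subset[OF that(3)] unfolding image_image
    by (intro image_cong) (auto simp: m_assoc inv_mult_group subset_iff)
  have le: "conj_class G ((\<lambda>h. a \<otimes> h \<otimes> inv a) ` K) \<subseteq> conj_class G K"
    if a: "a \<in> carrier G" "subgroup K G" for a K
  proof
    fix L assume "L \<in> conj_class G ((\<lambda>h. a \<otimes> h \<otimes> inv a) ` K)"
    then obtain g where "g \<in> carrier G" "L = (\<lambda>h. (g \<otimes> a) \<otimes> h \<otimes> inv (g \<otimes> a)) ` K"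
      using comp[OF _ a] by (auto simp: conj_class_eq)
    then show "L \<in> conj_class G K"
      using a m_closed[of g a] unfolding conj_class_eq by blast
  qed
  have "H = (\<lambda>h. inv g \<otimes> h \<otimes> inv (inv g)) ` (\<lambda>h. g \<otimes> h \<otimes> inv g) ` H"
    using comp[of "inv g" g H] H g subgroup.subset[OF H] by (auto simp: subset_iff image_iff)
  then show ?thesis
    using le[OF g H] le[OF inv_closed[OF g] subgroup_conjugate[OF H g]] by simp
qed

lemma conj_class_normal:
  assumes "N \<lhd> G"
  shows "conj_class G N = {N}"
proof -
  have "(\<lambda>h. g \<otimes> h \<otimes> inv g) ` N = N" if "g \<in> carrier G" for g
  proof
    have N: "subgroup N G" and cl: "\<And>x h. x \<in> carrier G \<Longrightarrow> h \<in> N \<Longrightarrow> x \<otimes> h \<otimes> inv x \<in> N"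
      using assms by (auto simp: normal_inv_iff)
    show "(\<lambda>h. g \<otimes> h \<otimes> inv g) ` N \<subseteq> N" using cl that by auto
    show "N \<subseteq> (\<lambda>h. g \<otimes> h \<otimes> inv g) ` N"
    proof
      fix h assume h: "h \<in> N"
      then have "h = g \<otimes> (inv g \<otimes> h \<otimes> inv (inv g)) \<otimes> inv g"
        using that subgroup.mem_carrier[OF N h] by (simp add: m_assoc mult_inv_cancel)
      then show "h \<in> (\<lambda>h. g \<otimes> h \<otimes> inv g) ` N"
        using cl[OF inv_closed[OF that] h] by blast
    qed
  qed
  then show ?thesis unfolding conj_class_eq using one_closed by auto
qed

lemma normal_core_normal:
  assumes "N \<lhd> G"
  shows "normal_core G N = N"
proof -
  have "g <# N #> inv g = N" if "g \<in> carrier G" for g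
    using conj_class_normal[OF assms] that unfolding conj_class_def by blast
  then show ?thesis unfolding normal_core_def using one_closed by auto
qed

end

abbreviation conj_classes :: "('a, 'm) monoid_scheme \<Rightarrow> 'a set set set" where
  "conj_classes G \<equiv> conj_class G ` {H. subgroup H G}"

abbreviation class_rep :: "'a set set \<Rightarrow> 'a set" where
  "class_rep C \<equiv> SOME H. H \<in> C"

text \<open>Left cosets are counted because they are the points of \<open>gset_cosets G N\<close>;
  the value is an integer so that it can appear directly as a mark.\<close>

definition index :: "('a, 'm) monoid_scheme \<Rightarrow> 'a set \<Rightarrow> int" where
  "index G N = int (card (lcosets\<^bsub>G\<^esub> N))"

definition normal_mark :: "('a, 'm) monoid_scheme \<Rightarrow> ('a set \<Rightarrow> int) \<Rightarrow> 'a set \<Rightarrow> int" where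
  "normal_mark G a H = (\<Sum>N | N \<lhd> G \<and> H \<subseteq> N. a N * index G N)"

definition normal_element :: "('a, 'm) monoid_scheme \<Rightarrow> ('a set \<Rightarrow> int) \<Rightarrow> 'a burnside" where
  "normal_element G a = (\<Oplus>\<^bsub>burnside_ring G\<^esub>N\<in>{N. N \<lhd> G}.
     [a N] \<cdot>\<^bsub>burnside_ring G\<^esub> gset_class G (gset_cosets G N))"

lemma carrier_normal_burnside_ring:
  "carrier (normal_burnside_ring G) = range (normal_element G)"
  by (auto simp: normal_burnside_ring_def normal_element_def)

section \<open>The table of marks and the coefficients of an element\<close>

context finite_group
begin

lemma finite_subgroups: "finite {H. subgroup H G}"
  by (rule finite_subset[of _ "Pow (carrier G)"]) (auto simp: finite_carrier dest: subgroup.subset)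

lemma finite_normal: "finite {N. N \<lhd> G}"
  by (rule finite_subset[OF _ finite_subgroups]) (auto simp: normal_imp_subgroup)

lemma finite_lcosets: "subgroup H G \<Longrightarrow> finite (lcosets H)"
  using finite_carrier by (simp add: LCOSETS_def)

lemma finite_gset_cosets: "subgroup H G \<Longrightarrow> finite_gset G (gset_cosets G H)"
  using group_action_cosets[of H] finite_lcosets[of H]
  by (simp add: finite_gset_def gset_cosets_def)

lemma mark_cosets_self:
  assumes "subgroup H G"
  shows "mark (gset_cosets G H) H > 0"
proof -
  have "\<one> <# H \<in> fixed_points (gset_cosets G H) H"
    unfolding fixed_points_cosets[OF assms subgroup.subset[OF assms]]
    using subgroup.mem_carrier[OF assms] by force
  then show ?thesis
    using finite_fixed_points[OF finite_gset_cosets[OF assms], of H]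
    by (auto simp: mark_def card_gt_0_iff)
qed

lemma mark_cosets_nonzero:
  assumes K: "subgroup K G" and H: "subgroup H G" and nz: "mark (gset_cosets G K) H \<noteq> 0"
  obtains g where "g \<in> carrier G" "H \<subseteq> (\<lambda>h. g \<otimes> h \<otimes> inv g) ` K"
proof -
  have "fixed_points (gset_cosets G K) H \<noteq> {}"
    using nz by (auto simp: mark_def)
  then obtain g where g: "g \<in> carrier G" and gK: "\<And>h. h \<in> H \<Longrightarrow> inv g \<otimes> h \<otimes> g \<in> K"
    using fixed_points_cosets[OF K subgroup.subset[OF H]] by auto
  have "h \<in> (\<lambda>h. g \<otimes> h \<otimes> inv g) ` K" if h: "h \<in> H" for h
  proof
    show "h = g \<otimes> (inv g \<otimes> h \<otimes> g) \<otimes> inv g"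
      using g subgroup.mem_carrier[OF H h] by (simp add: m_assoc mult_inv_cancel)
  qed (rule gK[OF h])
  then show thesis using g that by blast
qed

text \<open>A coset of \<open>g\<close> is fixed by \<open>h\<close> iff the conjugate of
  \<open>h\<close> by \<open>inv g\<close> lies in \<open>N\<close>. For normal \<open>N\<close>
  this does not depend on \<open>g\<close>, so \<open>H\<close> fixes either all cosets or
  none.\<close>

lemma mark_cosets_normal:
  assumes N: "N \<lhd> G" and H: "subgroup H G"
  shows "mark (gset_cosets G N) H = (if H \<subseteq> N then index G N else 0)"
proof -
  have sub: "subgroup N G" and cl: "\<And>x h. x \<in> carrier G \<Longrightarrow> h \<in> N \<Longrightarrow> x \<otimes> h \<otimes> inv x \<in> N"
    using N by (auto simp: normal_inv_iff)
  have "inv g \<otimes> h \<otimes> g \<in> N \<longleftrightarrow> h \<in> N" if g: "g \<in> carrier G" and h: "h \<in> carrier G" for g h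
  proof
    assume "inv g \<otimes> h \<otimes> g \<in> N"
    then have "g \<otimes> (inv g \<otimes> h \<otimes> g) \<otimes> inv g \<in> N" by (rule cl[OF g])
    moreover have "g \<otimes> (inv g \<otimes> h \<otimes> g) \<otimes> inv g = h"
      using g h by (simp add: m_assoc mult_inv_cancel)
    ultimately show "h \<in> N" by simp
  next
    assume "h \<in> N"
    then show "inv g \<otimes> h \<otimes> g \<in> N"
      using cl[of "inv g" h] g h by simp
  qed
  then have "fixed_points (gset_cosets G N) H = {g <# N | g. g \<in> carrier G \<and> H \<subseteq> N}"
    unfolding fixed_points_cosets[OF sub subgroup.subset[OF H]]
    using subgroup.mem_carrier[OF H] by (auto simp: subset_iff)
  also have "\<dots> = (if H \<subseteq> N then lcosets N else {})"
    by (auto simp: LCOSETS_def)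
  finally show ?thesis by (simp add: mark_def index_def)
qed

lemma class_rep:
  assumes "C \<in> conj_classes G"
  shows "subgroup (class_rep C) G" "conj_class G (class_rep C) = C"
proof -
  obtain H where H: "subgroup H G" "C = conj_class G H"
    using assms by auto
  have "class_rep C \<in> C"
    using conj_class_self[OF H(1)] H(2) by (metis someI)
  then obtain g where "g \<in> carrier G" "class_rep C = (\<lambda>h. g \<otimes> h \<otimes> inv g) ` H"
    using H(2) by (auto simp: conj_class_eq)
  then show "subgroup (class_rep C) G" "conj_class G (class_rep C) = C"
    using H by (simp_all add: subgroup_conjugate conj_class_conjugate)
qed

text \<open>A nonzero mark puts the representative of \<open>C\<close> inside a conjugate of that of
  \<open>D\<close>. The size assumption turns this inclusion into an equality, so both represent one
  class.\<close>

lemma mark_class_rep_eq: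
  assumes C: "C \<in> conj_classes G" and D: "D \<in> conj_classes G"
    and card: "card (class_rep D) \<le> card (class_rep C)"
    and nz: "mark (gset_cosets G (class_rep D)) (class_rep C) \<noteq> 0"
  shows "C = D"
proof -
  obtain g where g: "g \<in> carrier G" and sub: "class_rep C \<subseteq> (\<lambda>h. g \<otimes> h \<otimes> inv g) ` class_rep D"
    by (rule mark_cosets_nonzero[OF class_rep(1)[OF D] class_rep(1)[OF C] nz])
  have eq: "class_rep C = (\<lambda>h. g \<otimes> h \<otimes> inv g) ` class_rep D"
    using card sub finite_subgroup[OF class_rep(1)[OF D]]
    by (intro card_seteq) (auto simp: card_conjugate[OF class_rep(1)[OF D] g])
  have "C = conj_class G (class_rep C)" by (rule class_rep(2)[OF C, symmetric])
  also have "\<dots> = conj_class G (class_rep D)"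
    unfolding eq by (rule conj_class_conjugate[OF class_rep(1)[OF D] g])
  also have "\<dots> = D" by (rule class_rep(2)[OF D])
  finally show ?thesis .
qed

text \<open>
  Evaluate at a largest representative with nonzero coefficient: the table of marks is triangular.
\<close>
lemma cosets_independent:
  assumes zero: "\<And>H. subgroup H G \<Longrightarrow>
      (\<Sum>C\<in>conj_classes G. d C * mark (gset_cosets G (class_rep C)) H) = (0 :: int)"
    and "C \<in> conj_classes G"
  shows "d C = 0"
proof (rule ccontr)
  assume "d C \<noteq> 0"
  define B where "B = {C \<in> conj_classes G. d C \<noteq> 0}"
  have B: "finite B" "B \<noteq> {}"
    using finite_subgroups assms(2) \<open>d C \<noteq> 0\<close> by (auto simp: B_def)
  define m where "m = Max ((\<lambda>D. card (class_rep D)) ` B)"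
  have "m \<in> (\<lambda>D. card (class_rep D)) ` B"
    unfolding m_def using B by (intro Max_in) auto
  then obtain M where M: "M \<in> B" and m: "m = card (class_rep M)" by blast
  have max: "card (class_rep D) \<le> card (class_rep M)" if "D \<in> B" for D
    unfolding m[symmetric] m_def using B(1) that by (intro Max_ge) auto
  have Mc: "M \<in> conj_classes G" and dM: "d M \<noteq> 0"
    using M by (auto simp: B_def)
  have "(\<Sum>C\<in>conj_classes G. d C * mark (gset_cosets G (class_rep C)) (class_rep M)) =
      (\<Sum>C\<in>{M}. d C * mark (gset_cosets G (class_rep C)) (class_rep M))"
    using finite_subgroups Mc max mark_class_rep_eq[OF Mc]
    by (intro sum.mono_neutral_right) (auto simp: B_def)
  then show False
    using zero[OF class_rep(1)[OF Mc]] mark_cosets_self[OF class_rep(1)[OF Mc]] dM by simp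
qed

text \<open>Justifies the definite description: existence and uniqueness are both read off marks,
  uniqueness by applying \<open>cosets_independent\<close> to the difference of two candidates.
  Extensionality settles the values outside the set of conjugacy classes.\<close>

lemma burnside_coeffs_eqI:
  assumes a: "a \<in> extensional (conj_classes G)"
    and x: "x \<in> carrier R"
    and marks: "\<And>H. subgroup H G \<Longrightarrow>
      burnside_mark x H = (\<Sum>C\<in>conj_classes G. a C * mark (gset_cosets G (class_rep C)) H)"
  shows "burnside_coeffs G x = a"
proof -
  let ?t = "\<lambda>b C. [b C] \<cdot>\<^bsub>R\<^esub> gset_class G (gset_cosets G (class_rep C))"
  let ?s = "\<lambda>b :: 'a set set \<Rightarrow> int. finsum R (?t b) (conj_classes G)"
  have fin: "finite (conj_classes G)" using finite_subgroups by simp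
  have t: "?t b C \<in> carrier R" if "C \<in> conj_classes G" for b :: "'a set set \<Rightarrow> int" and C
    using that by (intro burnside_add_pow gset_class_carrier finite_gset_cosets class_rep)
  have s: "?s b \<in> carrier R" for b
    by (intro burnside_finsum fin t)
  have mark_s: "burnside_mark (?s b) H = (\<Sum>C\<in>conj_classes G. b C * mark (gset_cosets G (class_rep C)) H)"
    if H: "subgroup H G" for b H
    using burnside_finsum(2)[OF fin t H]
    by (simp add: burnside_add_pow(2) gset_class_carrier burnside_mark_gset_class
        finite_gset_cosets class_rep(1) H cong: sum.cong)
  show ?thesis
    unfolding burnside_coeffs_def
  proof (rule the_equality)
    show "a \<in> extensional (conj_classes G) \<and> x = ?s a"
      using a burnside_eqI[OF x s[of a]] by (simp add: marks mark_s)
    fix b assume b: "b \<in> extensional (conj_classes G) \<and> x = ?s b"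
    have "b C - a C = 0" if "C \<in> conj_classes G" for C
    proof (rule cosets_independent[OF _ that])
      fix H assume H: "subgroup H G"
      show "(\<Sum>C\<in>conj_classes G. (b C - a C) * mark (gset_cosets G (class_rep C)) H) = 0"
        using marks[OF H] mark_s[OF H, of b] b by (simp add: left_diff_distrib sum_subtractf)
    qed
    then show "b = a"
      using a b by (intro extensionalityI[of _ "conj_classes G"]) auto
  qed
qed

lemma normal_element_carrier: "normal_element G a \<in> carrier R"
  unfolding normal_element_def
  by (intro burnside_finsum burnside_add_pow gset_class_carrier finite_gset_cosets finite_normal)
    (simp add: normal_imp_subgroup)

lemma burnside_mark_normal_element:
  assumes H: "subgroup H G"
  shows "burnside_mark (normal_element G a) H = normal_mark G a H"
proof -
  have cl: "gset_class G (gset_cosets G N) \<in> carrier R" if "N \<lhd> G" for N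
    using that by (simp add: gset_class_carrier finite_gset_cosets normal_imp_subgroup)
  have "burnside_mark (normal_element G a) H =
      (\<Sum>N | N \<lhd> G. a N * (if H \<subseteq> N then index G N else 0))"
    unfolding normal_element_def
    by (subst burnside_finsum(2)[OF finite_normal _ H])
      (auto simp: burnside_add_pow cl H burnside_mark_gset_class finite_gset_cosets
        normal_imp_subgroup mark_cosets_normal intro!: sum.cong)
  also have "\<dots> = normal_mark G a H"
    unfolding normal_mark_def using finite_normal
    by (intro sum.mono_neutral_cong_right) auto
  finally show ?thesis .
qed

text \<open>The marks of a unit and of its inverse are integers with product 1. Conversely, if every
  mark is 1 or -1, the square has all marks 1, so the element is its own inverse and the inverse
  lies in the same subring.\<close>

lemma Units_normal_burnside_ring_iff:
  "normal_element G a \<in> Units (normal_burnside_ring G) \<longleftrightarrow>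
     (\<forall>H. subgroup H G \<longrightarrow> normal_mark G a H \<in> {1, -1})"
proof
  assume "normal_element G a \<in> Units (normal_burnside_ring G)"
  then obtain b where "normal_element G b \<otimes>\<^bsub>R\<^esub> normal_element G a = \<one>\<^bsub>R\<^esub>"
    by (auto simp: Units_def carrier_normal_burnside_ring) (auto simp: normal_burnside_ring_def)
  then have "normal_mark G b H * normal_mark G a H = 1" if "subgroup H G" for H
    using that burnside_mult(2)[OF normal_element_carrier normal_element_carrier that, of b a]
    by (simp add: burnside_one burnside_mark_normal_element)
  then show "\<forall>H. subgroup H G \<longrightarrow> normal_mark G a H \<in> {1, -1}"
    by (auto simp: zmult_eq_1_iff)
next
  assume marks: "\<forall>H. subgroup H G \<longrightarrow> normal_mark G a H \<in> {1, -1}"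
  have "normal_element G a \<otimes>\<^bsub>R\<^esub> normal_element G a = \<one>\<^bsub>R\<^esub>"
  proof (rule burnside_eqI)
    fix H assume "subgroup H G"
    then show "burnside_mark (normal_element G a \<otimes>\<^bsub>R\<^esub> normal_element G a) H = burnside_mark \<one>\<^bsub>R\<^esub> H"
      using marks by (auto simp: burnside_mult normal_element_carrier burnside_one burnside_mark_normal_element)
  qed (simp_all add: burnside_mult normal_element_carrier burnside_one)
  then show "normal_element G a \<in> Units (normal_burnside_ring G)"
    by (auto simp: Units_def carrier_normal_burnside_ring) (auto simp: normal_burnside_ring_def)
qed

text \<open>Many classes may share the core \<open>N\<close>, but the coefficients sit on classes of
  normal subgroups only, and a normal subgroup is its own core.\<close>

lemma core_coeff_normal_element:
  assumes N: "N \<lhd> G"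
  shows "core_coeff G N (normal_element G a) = a N"
proof -
  \<comment> \<open>The inner sum has at most one term. It encodes a case distinction:
    \<open>a M\<close> on the singleton class of a normal \<open>M\<close>, and the empty sum 0 on
    all other classes.\<close>
  define b where "b = restrict (\<lambda>C. \<Sum>M | M \<lhd> G \<and> C = {M}. a M) (conj_classes G)"
  have b: "b (conj_class G H) = (if H \<lhd> G then a H else 0)" if "subgroup H G" for H
  proof -
    have "{M. M \<lhd> G \<and> conj_class G H = {M}} = (if H \<lhd> G then {H} else {})"
      using conj_class_self[OF that] conj_class_normal[of H] by auto
    then show ?thesis using that by (simp add: b_def)
  qed
  have norm: "conj_class G ` {N. N \<lhd> G} = (\<lambda>M. {M}) ` {N. N \<lhd> G}"
    by (rule image_cong) (simp_all add: conj_class_normal)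
  have "burnside_coeffs G (normal_element G a) = b"
  proof (rule burnside_coeffs_eqI)
    fix H assume H: "subgroup H G"
    have "(\<Sum>C\<in>conj_classes G. b C * mark (gset_cosets G (class_rep C)) H) =
        (\<Sum>C\<in>(\<lambda>M. {M}) ` {N. N \<lhd> G}. b C * mark (gset_cosets G (class_rep C)) H)"
      unfolding norm[symmetric] using finite_subgroups
      by (intro sum.mono_neutral_right) (auto simp: b normal_imp_subgroup)
    also have "\<dots> = (\<Sum>M | M \<lhd> G. b {M} * mark (gset_cosets G M) H)"
      by (subst sum.reindex) auto
    also have "\<dots> = (\<Sum>M | M \<lhd> G. a M * (if H \<subseteq> M then index G M else 0))"
    proof (rule sum.cong)
      fix M assume "M \<in> {M. M \<lhd> G}"
      then show "b {M} * mark (gset_cosets G M) H = a M * (if H \<subseteq> M then index G M else 0)"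
        using b[of M] by (simp add: conj_class_normal normal_imp_subgroup mark_cosets_normal H)
    qed simp
    also have "\<dots> = normal_mark G a H"
      unfolding normal_mark_def using finite_normal
      by (intro sum.mono_neutral_cong_right) auto
    finally show "burnside_mark (normal_element G a) H =
        (\<Sum>C\<in>conj_classes G. b C * mark (gset_cosets G (class_rep C)) H)"
      by (simp add: burnside_mark_normal_element H)
  qed (simp_all add: b_def normal_element_carrier)
  then have "core_coeff G N (normal_element G a) =
      (\<Sum>C\<in>conj_class G ` {H. subgroup H G \<and> normal_core G H = N}. b C)"
    by (simp add: core_coeff_def)
  also have "\<dots> = (\<Sum>C\<in>{conj_class G N}. b C)"
  proof (intro sum.mono_neutral_right ballI)
    fix C assume C: "C \<in> conj_class G ` {H. subgroup H G \<and> normal_core G H = N} - {conj_class G N}"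
    then obtain H where H: "subgroup H G" "normal_core G H = N" "C = conj_class G H" by auto
    \<comment> \<open>A normal \<open>H\<close> would equal its core \<open>N\<close>, and its class
      is the one just removed.\<close>
    then have "\<not> H \<lhd> G" using C normal_core_normal[of H] by auto
    then show "b C = 0" using H by (simp add: b)
  qed (use N finite_subgroups in \<open>auto simp: normal_core_normal normal_imp_subgroup\<close>)
  also have "\<dots> = a N"
    using N by (simp add: b normal_imp_subgroup)
  finally show ?thesis .
qed

text \<open>From here on the Burnside ring disappears: what remains concerns integer functions on
  normal subgroups and their \<open>normal_mark\<close> sums.\<close>

lemma exists_unit_iff:
  assumes "N \<lhd> G"
  shows "(\<exists>u\<in>Units (normal_burnside_ring G). core_coeff G N u \<noteq> 0) \<longleftrightarrow>
    (\<exists>a. (\<forall>H. subgroup H G \<longrightarrow> normal_mark G a H \<in> {1, -1}) \<and> a N \<noteq> 0)"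
proof -
  have "u \<in> range (normal_element G)" if "u \<in> Units (normal_burnside_ring G)" for u
    using that by (simp add: Units_def carrier_normal_burnside_ring)
  then have "(\<exists>u\<in>Units (normal_burnside_ring G). core_coeff G N u \<noteq> 0) \<longleftrightarrow>
      (\<exists>a. normal_element G a \<in> Units (normal_burnside_ring G) \<and> core_coeff G N (normal_element G a) \<noteq> 0)"
    by blast
  then show ?thesis
    by (simp only: Units_normal_burnside_ring_iff core_coeff_normal_element[OF assms])
qed

end


section \<open>Subgroups containing all squares\<close>

text \<open>The quotient condition restated inside \<open>G\<close>. In this form it visibly passes
  to larger subgroups and to intersections, and it implies normality, so subgroups can be built
  without working in a quotient.\<close>

definition contains_squares :: "('a, 'm) monoid_scheme \<Rightarrow> 'a set \<Rightarrow> bool" where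
  "contains_squares G H \<longleftrightarrow> subgroup H G \<and> (\<forall>x\<in>carrier G. x \<otimes>\<^bsub>G\<^esub> x \<in> H)"

context group
begin

lemma nat_pow_two: "x \<in> carrier G \<Longrightarrow> x [^] (2::nat) = x \<otimes> x"
  by (simp add: numeral_2_eq_2)

lemma comm_group_if_squares_trivial:
  assumes "\<And>x. x \<in> carrier G \<Longrightarrow> x \<otimes> x = \<one>"
  shows "comm_group G"
proof (rule group_comm_groupI)
  fix x y assume xy: "x \<in> carrier G" "y \<in> carrier G"
  have inv: "inv z = z" if "z \<in> carrier G" for z
    using assms[OF that] that by (simp add: inv_equality)
  show "x \<otimes> y = y \<otimes> x"
    using inv_mult_group[OF xy] xy by (simp add: inv)
qed

text \<open>A conjugate is a product of squares and an element of \<open>H\<close>: x h x^-1 = (x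
  h)^2 h^-1 (x^-1)^2.\<close>

lemma contains_squares_normal:
  assumes "contains_squares G H"
  shows "H \<lhd> G"
proof -
  have H: "subgroup H G" and sq: "\<And>x. x \<in> carrier G \<Longrightarrow> x \<otimes> x \<in> H"
    using assms by (auto simp: contains_squares_def)
  have "x \<otimes> h \<otimes> inv x \<in> H" if x: "x \<in> carrier G" and h: "h \<in> H" for x h
  proof -
    have hc: "h \<in> carrier G" by (rule subgroup.mem_carrier[OF H h])
    have "((x \<otimes> h) \<otimes> (x \<otimes> h)) \<otimes> inv h \<otimes> (inv x \<otimes> inv x) \<in> H"
      by (rule subgroup.m_closed[OF H subgroup.m_closed[OF H sq[OF m_closed[OF x hc]]
            subgroup.m_inv_closed[OF H h]] sq[OF inv_closed[OF x]]])
    also have "((x \<otimes> h) \<otimes> (x \<otimes> h)) \<otimes> inv h \<otimes> (inv x \<otimes> inv x) = x \<otimes> h \<otimes> inv x"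
      using x hc by (simp add: m_assoc mult_inv_cancel)
    finally show ?thesis .
  qed
  then show ?thesis using H by (simp add: normal_inv_iff)
qed

text \<open>Modulo \<open>N\<close> the element \<open>x\<close> has order at most 2, so
  \<open>N\<close> and its translate already form the subgroup generated by both. If
  \<open>x\<close> lies in \<open>N\<close>, the union is just \<open>N\<close>.\<close>

lemma contains_squares_adjoin:
  assumes N: "contains_squares G N" and x: "x \<in> carrier G"
  shows "contains_squares G (N \<union> (x <# N))"
proof -
  have H: "subgroup N G" and sq: "\<And>x. x \<in> carrier G \<Longrightarrow> x \<otimes> x \<in> N"
    using N by (auto simp: contains_squares_def)
  note normal = contains_squares_normal[OF N]
  have mem: "z \<in> x <# N \<longleftrightarrow> z \<in> carrier G \<and> inv x \<otimes> z \<in> N" for z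
    using subgroup.lcos_module_imp[OF H is_group x] subgroup.lcos_module_rev[OF H is_group x]
      l_coset_carrier[OF _ x H] by blast
  have conj: "inv y \<otimes> n \<otimes> y \<in> N" if "y \<in> carrier G" "n \<in> N" for y n
    by (rule normal.inv_op_closed1[OF normal that])
  have NN: "m \<in> N \<Longrightarrow> n \<in> N \<Longrightarrow> m \<otimes> n \<in> N" for m n
    by (rule subgroup.m_closed[OF H])
  have Nc: "n \<in> carrier G" if "n \<in> N" for n by (rule subgroup.mem_carrier[OF H that])
  have xN: "z \<in> x <# N \<Longrightarrow> \<exists>n\<in>N. z = x \<otimes> n" for z by (auto simp: l_coset_def)
  have "subgroup (N \<union> (x <# N)) G"
  proof (rule subgroupI)
    show "N \<union> (x <# N) \<subseteq> carrier G" using Nc mem by auto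
    show "N \<union> (x <# N) \<noteq> {}" using subgroup.one_closed[OF H] by auto
    fix y assume y: "y \<in> N \<union> (x <# N)"
    then have yc: "y \<in> carrier G" using Nc mem by auto
    show "inv y \<in> N \<union> (x <# N)"
    proof (cases "y \<in> N")
      case True
      then show ?thesis using subgroup.m_inv_closed[OF H] by simp
    next
      case False
      then obtain n where n: "n \<in> N" "y = x \<otimes> n" using y xN by auto
      \<comment> \<open>With y = x n this reads x^-1 n^-1 x^-1 = x^-2 (x n^-1 x^-1): the inverse of
        a square times a conjugate of an element of \<open>N\<close>.\<close>
      have "inv x \<otimes> inv y = inv (x \<otimes> x) \<otimes> (inv (inv x) \<otimes> inv n \<otimes> inv x)"
        using n x Nc[OF n(1)] by (simp add: inv_mult_group m_assoc mult_inv_cancel)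
      also have "\<dots> \<in> N"
        by (rule NN[OF subgroup.m_inv_closed[OF H sq[OF x]]
            conj[OF inv_closed[OF x] subgroup.m_inv_closed[OF H n(1)]]])
      finally show ?thesis using yc mem by simp
    qed
    fix z assume z: "z \<in> N \<union> (x <# N)"
    then have zc: "z \<in> carrier G" using Nc mem by auto
    show "y \<otimes> z \<in> N \<union> (x <# N)"
    proof (cases "y \<in> N"; cases "z \<in> N")
      assume "y \<in> N" "z \<in> N"
      then show ?thesis using NN by simp
    next
      assume yN: "y \<in> N" and "z \<notin> N"
      then obtain n where n: "n \<in> N" "z = x \<otimes> n" using z xN by auto
      have "inv x \<otimes> (y \<otimes> z) = (inv x \<otimes> y \<otimes> x) \<otimes> n"
        using n x yc Nc[OF n(1)] by (simp add: m_assoc)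
      also have "\<dots> \<in> N" using n conj[OF x yN] NN by simp
      finally show ?thesis using yc zc mem by simp
    next
      assume "y \<notin> N" and zN: "z \<in> N"
      then have "inv x \<otimes> y \<in> N" using y mem by auto
      then have "inv x \<otimes> y \<otimes> z \<in> N" using NN zN by simp
      then show ?thesis using yc zc x mem by (simp add: m_assoc)
    next
      assume "y \<notin> N" "z \<notin> N"
      then obtain m n where m: "m \<in> N" "y = x \<otimes> m" and n: "n \<in> N" "z = x \<otimes> n"
        using y z xN by blast
      \<comment> \<open>Normality moves the second \<open>x\<close> past \<open>m\<close>; the two
        factors \<open>x\<close> then meet in a square, so the product of two elements of the
        translate falls into \<open>N\<close>.\<close>
      have "y \<otimes> z = (x \<otimes> x) \<otimes> ((inv x \<otimes> m \<otimes> x) \<otimes> n)"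
        using m n x Nc by (simp add: m_assoc mult_inv_cancel)
      also have "\<dots> \<in> N" using m n sq[OF x] conj[OF x] NN by simp
      finally show ?thesis by simp
    qed
  qed
  then show ?thesis using sq by (simp add: contains_squares_def)
qed

text \<open>A group in which all squares vanish is commutative, so only the condition on squares has
  to be translated to cosets.\<close>

lemma elementary_abelian_2_group_Mod_iff:
  assumes N: "N \<lhd> G"
  shows "elementary_abelian_2_group (G Mod N) \<longleftrightarrow> contains_squares G N"
proof -
  interpret normal N G by (rule N)
  interpret Q: group "G Mod N" by (rule factorgroup_is_group)
  have sub: "subgroup N G" by (rule normal_imp_subgroup[OF N])
  have coset: "(N #> x) \<otimes>\<^bsub>G Mod N\<^esub> (N #> x) = \<one>\<^bsub>G Mod N\<^esub> \<longleftrightarrow> x \<otimes> x \<in> N" if "x \<in> carrier G" for x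
    using that coset_join1[OF _ _ sub, of "x \<otimes> x"] coset_join2[OF _ sub, of "x \<otimes> x"]
    by (auto simp: FactGroup_def rcos_sum)
  have "(\<forall>X\<in>carrier (G Mod N). X \<otimes>\<^bsub>G Mod N\<^esub> X = \<one>\<^bsub>G Mod N\<^esub>) \<longleftrightarrow> contains_squares G N"
    using coset sub by (auto simp: contains_squares_def carrier_FactGroup)
  moreover have "elementary_abelian_2_group (G Mod N) \<longleftrightarrow>
      (\<forall>X\<in>carrier (G Mod N). X \<otimes>\<^bsub>G Mod N\<^esub> X = \<one>\<^bsub>G Mod N\<^esub>)"
    using Q.comm_group_if_squares_trivial
    by (auto simp: elementary_abelian_2_group_def Q.nat_pow_two)
  ultimately show ?thesis by simp
qed

end

section \<open>Indices and the two directions of the theorem\<close>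

context finite_group
begin

lemma index_card: "subgroup H G \<Longrightarrow> index G H * int (card H) = int (order G)"
  using l_lagrange[OF finite_carrier, of H] by (simp add: index_def flip: of_nat_mult)

lemma subgroup_card_pos: "subgroup H G \<Longrightarrow> card H > 0"
  using finite_subgroup subgroup.one_closed by (fastforce simp: card_gt_0_iff)

lemma index_carrier: "index G (carrier G) = 1"
  using index_card[OF subgroup_self] subgroup_card_pos[OF subgroup_self] by (simp add: order_def)

text \<open>The order of the quotient annihilates every element and divides 2, hence so does the
  exponent 2.\<close>

lemma contains_squares_if_index_dvd_2:
  assumes N: "N \<lhd> G" and dvd: "index G N dvd 2"
  shows "contains_squares G N"
proof -
  interpret normal N G by (rule N)
  interpret Q: group "G Mod N" by (rule factorgroup_is_group)
  have sub: "subgroup N G" by (rule normal_imp_subgroup[OF N])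
  \<comment> \<open>\<open>index\<close> counts left cosets while \<open>G Mod N\<close> consists of
    right cosets; the two forms of Lagrange's theorem reconcile them.\<close>
  have "card (rcosets N) * card N = card (lcosets N) * card N"
    using lagrange[OF sub] l_lagrange[OF finite_carrier sub] by simp
  then have "order (G Mod N) = card (lcosets N)"
    using subgroup_card_pos[OF sub] by (simp add: order_def FactGroup_def)
  then have "int (order (G Mod N)) dvd int 2"
    using dvd by (simp add: index_def)
  then obtain k where k: "2 = order (G Mod N) * k"
    unfolding int_dvd_int_iff by (elim dvdE)
  have "X \<otimes>\<^bsub>G Mod N\<^esub> X = \<one>\<^bsub>G Mod N\<^esub>" if X: "X \<in> carrier (G Mod N)" for X
  proof -
    have "X \<otimes>\<^bsub>G Mod N\<^esub> X = X [^]\<^bsub>G Mod N\<^esub> (2::nat)"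
      by (rule Q.nat_pow_two[OF X, symmetric])
    also have "\<dots> = (X [^]\<^bsub>G Mod N\<^esub> order (G Mod N)) [^]\<^bsub>G Mod N\<^esub> k"
      unfolding k using X by (simp add: Q.nat_pow_pow)
    also have "\<dots> = \<one>\<^bsub>G Mod N\<^esub>"
      by (simp only: Q.pow_order_eq_1[OF X] Q.nat_pow_one)
    finally show ?thesis .
  qed
  then have "elementary_abelian_2_group (G Mod N)"
    using Q.comm_group_if_squares_trivial
    by (auto simp: elementary_abelian_2_group_def Q.nat_pow_two)
  then show ?thesis by (simp add: elementary_abelian_2_group_Mod_iff[OF N])
qed

theorem contains_squares_if_coeff_nonzero:
  assumes unit: "\<And>H. subgroup H G \<Longrightarrow> normal_mark G a H \<in> {1, -1}"
    and N: "N \<lhd> G" "a N \<noteq> 0"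
  shows "contains_squares G N"
proof (rule ccontr)
  assume "\<not> contains_squares G N"
  define B where "B = {N. N \<lhd> G \<and> a N \<noteq> 0 \<and> \<not> contains_squares G N}"
  have B: "finite B" "B \<noteq> {}"
    using finite_normal N \<open>\<not> contains_squares G N\<close> by (auto simp: B_def)
  then obtain P where P: "P \<in> B" and max: "\<And>L. L \<in> B \<Longrightarrow> P \<subseteq> L \<Longrightarrow> P = L"
    using finite_has_maximal[OF B] by blast
  have Pn: "P \<lhd> G" and aP: "a P \<noteq> 0" and Psq: "\<not> contains_squares G P"
    using P by (auto simp: B_def)
  \<comment> \<open>The family contains the whole group, so it is nonempty, and its intersection is
    again a subgroup containing all squares.\<close>
  define M where "M = \<Inter>{L. contains_squares G L \<and> P \<subseteq> L}"
  have "contains_squares G (carrier G)"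
    by (simp add: contains_squares_def subgroup_self)
  then have ne: "{L. contains_squares G L \<and> P \<subseteq> L} \<noteq> {}"
    using subgroup.subset[OF normal_imp_subgroup[OF Pn]] by blast
  have Msub: "subgroup M G"
    unfolding M_def using ne by (intro subgroups_Inter) (auto simp: contains_squares_def)
  then have Msq: "contains_squares G M"
    by (auto simp: contains_squares_def M_def)
  have PM: "P \<subseteq> M" by (auto simp: M_def)
  then have MP: "\<not> M \<subseteq> P" using Msq Psq by auto
  \<comment> \<open>A normal \<open>L\<close> above \<open>P\<close> and outside the new index set
    fails to contain all squares, since otherwise \<open>M\<close> would lie below it. Being
    different from \<open>P\<close>, it has coefficient 0 by maximality of \<open>P\<close>.\<close>
  have "normal_mark G a P = (\<Sum>L\<in>insert P {L. L \<lhd> G \<and> M \<subseteq> L}. a L * index G L)"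
    unfolding normal_mark_def
  proof (intro sum.mono_neutral_right ballI)
    fix L assume L: "L \<in> {L. L \<lhd> G \<and> P \<subseteq> L} - insert P {L. L \<lhd> G \<and> M \<subseteq> L}"
    then have "\<not> contains_squares G L" by (auto simp: M_def)
    then show "a L * index G L = 0" using L max[of L] by (auto simp: B_def)
  qed (use finite_normal Pn PM in auto)
  also have "\<dots> = a P * index G P + normal_mark G a M"
    unfolding normal_mark_def using finite_normal MP by (subst sum.insert) auto
  finally have eq: "a P * index G P = normal_mark G a P - normal_mark G a M" by simp
  have "index G P dvd 2"
  proof -
    have "index G P \<noteq> 0"
      using index_card[OF normal_imp_subgroup[OF Pn]] subgroup_card_pos[OF subgroup_self]
      by (auto simp: order_def)
    then have "a P * index G P \<noteq> 0" using aP by simp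
    then have "a P * index G P \<in> {2, -2}"
      using eq unit[OF normal_imp_subgroup[OF Pn]] unit[OF Msub] by auto
    then show ?thesis
      by (metis dvd_minus_iff dvd_triv_right empty_iff insert_iff)
  qed
  then show False using contains_squares_if_index_dvd_2[OF Pn] Psq by simp
qed

text \<open>In the vector space G/N this is a hyperplane missing a given nonzero vector. Instead of
  choosing a basis, take \<open>K\<close> maximal among the candidates avoiding \<open>x\<close>:
  adjoining any \<open>y\<close> outside \<open>K\<close> must capture \<open>x\<close>, so
  \<open>x\<close> lies in the coset of \<open>y\<close>. The last conclusion says that
  \<open>K\<close> and its translate by \<open>x\<close> cover \<open>G\<close>.\<close>

lemma complement_index_2:
  assumes N: "contains_squares G N" and x: "x \<in> carrier G" "x \<notin> N"
  obtains K where "contains_squares G K" "N \<subseteq> K" "x \<notin> K"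
    "\<And>y. y \<in> carrier G \<Longrightarrow> y \<notin> K \<Longrightarrow> inv x \<otimes> y \<in> K"
proof -
  define B where "B = {K. contains_squares G K \<and> N \<subseteq> K \<and> x \<notin> K}"
  have "finite B" "N \<in> B"
    using N x finite_subset[OF _ finite_subgroups, of B] by (auto simp: B_def contains_squares_def)
  then obtain K where K: "K \<in> B" and max: "\<And>L. L \<in> B \<Longrightarrow> K \<subseteq> L \<Longrightarrow> K = L"
    using finite_has_maximal[of B] by blast
  have Ksq: "contains_squares G K" and NK: "N \<subseteq> K" and xK: "x \<notin> K"
    using K by (auto simp: B_def)
  have Ksub: "subgroup K G" using Ksq by (simp add: contains_squares_def)
  have "inv x \<otimes> y \<in> K" if y: "y \<in> carrier G" "y \<notin> K" for y
  proof -
    have "x \<in> K \<union> (y <# K)"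
    proof (rule ccontr)
      assume "x \<notin> K \<union> (y <# K)"
      then have "K \<union> (y <# K) \<in> B"
        using contains_squares_adjoin[OF Ksq y(1)] NK by (auto simp: B_def)
      then show False
        using max lcos_self[OF y(1) Ksub] y(2) by blast
    qed
    then have "inv y \<otimes> x \<in> K"
      using xK subgroup.lcos_module_imp[OF Ksub is_group y(1)] by auto
    then have "inv (inv y \<otimes> x) \<in> K" by (rule subgroup.m_inv_closed[OF Ksub])
    then show ?thesis using x y by (simp add: inv_mult_group)
  qed
  then show thesis using Ksq NK xK that by blast
qed

text \<open>The two cosets of \<open>K\<close> in \<open>G\<close> cut \<open>L\<close> into two
  translates of \<open>L \<inter> K\<close>, because the coset representative \<open>x\<close> can
  be taken in \<open>L\<close>.\<close>

lemma card_inter_index_2: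
  assumes L: "subgroup L G" and K: "subgroup K G" and x: "x \<in> L" "x \<notin> K"
    and cover: "\<And>y. y \<in> carrier G \<Longrightarrow> y \<notin> K \<Longrightarrow> inv x \<otimes> y \<in> K"
  shows "L = (L \<inter> K) \<union> (x <# (L \<inter> K))" "card L = 2 * card (L \<inter> K)"
proof -
  have xc: "x \<in> carrier G" by (rule subgroup.mem_carrier[OF L x(1)])
  have LK: "subgroup (L \<inter> K) G" by (rule subgroups_Inter_pair[OF L K])
  show eq: "L = (L \<inter> K) \<union> (x <# (L \<inter> K))"
  proof (intro equalityI subsetI)
    fix y assume y: "y \<in> L"
    then have yc: "y \<in> carrier G" by (rule subgroup.mem_carrier[OF L])
    have "inv x \<otimes> y \<in> L"
      using subgroup.m_closed[OF L subgroup.m_inv_closed[OF L x(1)] y] .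
    then have "y \<notin> K \<Longrightarrow> y \<in> x <# (L \<inter> K)"
      using cover[OF yc] subgroup.lcos_module_rev[OF LK is_group xc yc] by simp
    then show "y \<in> (L \<inter> K) \<union> (x <# (L \<inter> K))" using y by blast
  next
    fix y assume "y \<in> (L \<inter> K) \<union> (x <# (L \<inter> K))"
    then show "y \<in> L" using subgroup.m_closed[OF L x(1)] by (auto simp: l_coset_def)
  qed
  have "(L \<inter> K) \<inter> (x <# (L \<inter> K)) = {}"
  proof -
    have "x \<in> K" if h: "h \<in> K" "x \<otimes> h \<in> K" for h
    proof -
      have "(x \<otimes> h) \<otimes> inv h \<in> K"
        using h subgroup.m_closed[OF K] subgroup.m_inv_closed[OF K] by blast
      then show ?thesis using h xc subgroup.mem_carrier[OF K h(1)] by (simp add: m_assoc)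
    qed
    then show ?thesis using x by (auto simp: l_coset_def)
  qed
  moreover have "card (x <# (L \<inter> K)) = card (L \<inter> K)"
    using xc by (intro l_card_cosets_equal[OF _ subgroup.subset[OF LK] finite_carrier, symmetric])
      (auto simp: LCOSETS_def)
  moreover have "finite (L \<inter> K)" "finite (x <# (L \<inter> K))"
    using eq finite_subgroup[OF L] by (metis finite_Un)+
  ultimately have "card ((L \<inter> K) \<union> (x <# (L \<inter> K))) = 2 * card (L \<inter> K)"
    by (simp add: card_Un_disjoint)
  then show "card L = 2 * card (L \<inter> K)" using eq by simp
qed

lemma index_inter_index_2:
  assumes L: "subgroup L G" and K: "subgroup K G" and "x \<in> L" "x \<notin> K"
    and "\<And>y. y \<in> carrier G \<Longrightarrow> y \<notin> K \<Longrightarrow> inv x \<otimes> y \<in> K"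
  shows "index G (L \<inter> K) = 2 * index G L"
proof -
  have LK: "subgroup (L \<inter> K) G" by (rule subgroups_Inter_pair[OF L K])
  have "index G (L \<inter> K) * int (card (L \<inter> K)) = 2 * index G L * int (card (L \<inter> K))"
    using index_card[OF LK] index_card[OF L] card_inter_index_2(2)[OF assms] by simp
  then show ?thesis using subgroup_card_pos[OF LK] by simp
qed

text \<open>The support condition is what makes the induction work: coefficients living above
  \<open>M\<close> only involve subgroups that contain \<open>x\<close>, and they vanish at
  \<open>N\<close>.\<close>

theorem exists_unit_coeffs:
  assumes "contains_squares G N"
  shows "\<exists>a. (\<forall>L. a L \<noteq> 0 \<longrightarrow> L \<lhd> G \<and> N \<subseteq> L) \<and>
    (\<forall>H. subgroup H G \<longrightarrow> normal_mark G a H \<in> {1, -1}) \<and> a N \<noteq> 0"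
  using assms
proof (induction "card (carrier G) - card N" arbitrary: N rule: less_induct)
  case less
  note N = less.prems
  have Nsub: "subgroup N G" using N by (simp add: contains_squares_def)
  show ?case
  proof (cases "N = carrier G")
    case True
    \<comment> \<open>The base case is the identity [G/G] of the ring.\<close>
    have "normal_mark G (\<lambda>L. if L = carrier G then 1 else 0) H = 1" if H: "subgroup H G" for H
    proof -
      have "normal_mark G (\<lambda>L. if L = carrier G then 1 else 0) H =
          (\<Sum>L\<in>{carrier G}. (if L = carrier G then 1 else 0) * index G L)"
        unfolding normal_mark_def
        using finite_normal contains_squares_normal[OF N] True subgroup.subset[OF H]
        by (intro sum.mono_neutral_right) auto
      then show ?thesis by (simp add: index_carrier)
    qed
    then show ?thesis
      using True contains_squares_normal[OF N]
      by (intro exI[of _ "\<lambda>L. if L = carrier G then 1 else 0"]) simp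
  next
    case False
    then obtain x where x: "x \<in> carrier G" "x \<notin> N"
      using subgroup.subset[OF Nsub] by blast
    define M where "M = N \<union> (x <# N)"
    have M: "contains_squares G M"
      unfolding M_def by (rule contains_squares_adjoin[OF N x(1)])
    have xM: "x \<in> M" using lcos_self[OF x(1) Nsub] by (simp add: M_def)
    have Msub: "subgroup M G" using M by (simp add: contains_squares_def)
    have "card N < card M"
      using xM x finite_subgroup[OF Msub] by (intro psubset_card_mono) (auto simp: M_def)
    moreover have "card M \<le> card (carrier G)"
      by (rule card_mono[OF finite_carrier subgroup.subset[OF Msub]])
    ultimately have "card (carrier G) - card M < card (carrier G) - card N" by linarith
    from less.hyps[OF this M] obtain a where
      supp: "\<And>L. a L \<noteq> 0 \<Longrightarrow> L \<lhd> G \<and> M \<subseteq> L" and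
      unit: "\<And>H. subgroup H G \<Longrightarrow> normal_mark G a H \<in> {1, -1}" and aM: "a M \<noteq> 0"
      by blast
    obtain K where K: "contains_squares G K" "N \<subseteq> K" "x \<notin> K"
      and cover: "\<And>y. y \<in> carrier G \<Longrightarrow> y \<notin> K \<Longrightarrow> inv x \<otimes> y \<in> K"
      using complement_index_2[OF N x] by blast
    have Ksub: "subgroup K G" using K by (simp add: contains_squares_def)
    have Kn: "K \<lhd> G" by (rule contains_squares_normal[OF K(1)])
    \<comment> \<open>the coefficients of the product with \<open>1 - [G/K]\<close>: as \<open>L' K = G\<close>, \<open>[G/L'] [G/K] = [G/(L' \<inter> K)]\<close>\<close>
    define b where "b = (\<lambda>L. a L - (\<Sum>L' | L' \<lhd> G \<and> L' \<inter> K = L. a L'))"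
    \<comment> \<open>A nonzero coefficient puts \<open>L\<close> above \<open>M\<close>, so
      \<open>x\<close> lies in \<open>L\<close> but not in \<open>K\<close>.\<close>
    have split: "L = (L \<inter> K) \<union> (x <# (L \<inter> K))" "index G (L \<inter> K) = 2 * index G L" if "a L \<noteq> 0" for L
      using card_inter_index_2(1)[of L K x] index_inter_index_2[of L K x] that supp[OF that]
        normal_imp_subgroup[of L G] Ksub K(3) cover xM by blast+
    have "normal_mark G b H \<in> {1, -1}" if H: "subgroup H G" for H
    proof -
      let ?S = "{L. L \<lhd> G \<and> H \<subseteq> L}" and ?T = "{L. L \<lhd> G \<and> H \<subseteq> L \<inter> K}"
      have fin: "finite ?S" "finite ?T"
        using finite_normal by (auto intro: rev_finite_subset)
      \<comment> \<open>Regrouping by \<open>L'\<close> instead of by its trace \<open>L\<close>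
        evaluates the subtracted part. The index doubles wherever \<open>a L'\<close> is nonzero, so
        this part is twice the old mark if \<open>H\<close> lies in \<open>K\<close> and an empty
        sum otherwise: the new mark is the old one up to sign.\<close>
      have "(\<Sum>L\<in>?S. (\<Sum>L' | L' \<lhd> G \<and> L' \<inter> K = L. a L') * index G L) =
          (\<Sum>L\<in>?S. \<Sum>L' | L' \<in> ?T \<and> L' \<inter> K = L. a L' * index G (L' \<inter> K))"
        unfolding sum_distrib_right by (intro sum.cong) auto
      also have "\<dots> = (\<Sum>L'\<in>?T. a L' * index G (L' \<inter> K))"
        using fin by (intro sum.group) (auto simp: normal_subgroup_intersect[OF _ Kn])
      also have "\<dots> = (\<Sum>L'\<in>?T. 2 * (a L' * index G L'))"
        using split(2) by (intro sum.cong) auto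
      also have "\<dots> = (if H \<subseteq> K then 2 * normal_mark G a H else 0)"
        by (simp add: normal_mark_def sum_distrib_left)
      finally have "normal_mark G b H =
          normal_mark G a H - (if H \<subseteq> K then 2 * normal_mark G a H else 0)"
        by (simp add: normal_mark_def b_def left_diff_distrib sum_subtractf)
      then show ?thesis using unit[OF H] by auto
    qed
    \<comment> \<open>No cancellation: by \<open>split\<close> an \<open>L\<close> in the support
      with trace \<open>N\<close> on \<open>K\<close> must be \<open>M\<close>, while
      \<open>a N\<close> is 0 because \<open>N\<close> misses \<open>x\<close>. So the coefficient
      at \<open>N\<close> is that of \<open>M\<close> with the opposite sign.\<close>
    moreover have "b N \<noteq> 0"
    proof -
      have eqM: "L = M" if "a L \<noteq> 0" "L \<inter> K = N" for L
        using split(1)[OF that(1)] that(2) by (simp add: M_def)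
      have MK: "M \<inter> K = N"
      proof -
        have "M \<inter> K = N \<inter> K \<union> (x <# N) \<inter> K" by (auto simp: M_def)
        moreover have "(x <# N) \<inter> K = {}"
        proof -
          have "x \<in> K" if h: "h \<in> K" "x \<otimes> h \<in> K" for h
          proof -
            have "(x \<otimes> h) \<otimes> inv h \<in> K"
              using h subgroup.m_closed[OF Ksub] subgroup.m_inv_closed[OF Ksub] by blast
            then show ?thesis using h x subgroup.mem_carrier[OF Ksub h(1)] by (simp add: m_assoc)
          qed
          then show ?thesis using K by (auto simp: l_coset_def)
        qed
        ultimately show ?thesis using K(2) by auto
      qed
      have "(\<Sum>L' | L' \<lhd> G \<and> L' \<inter> K = N. a L') = (\<Sum>L'\<in>{M}. a L')"
        using finite_normal eqM MK contains_squares_normal[OF M]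
        by (intro sum.mono_neutral_right) auto
      moreover have "a N = 0" using supp[of N] xM x by blast
      ultimately show ?thesis using aM by (simp add: b_def)
    qed
    moreover have "L \<lhd> G \<and> N \<subseteq> L" if "b L \<noteq> 0" for L
    proof -
      \<comment> \<open>A new subgroup in the support is an old one or the trace of an old one; both
        contain \<open>N\<close>, which lies below \<open>M\<close> and below
        \<open>K\<close>.\<close>
      have "a L \<noteq> 0 \<or> (\<exists>L'. a L' \<noteq> 0 \<and> L' \<inter> K = L)"
        using that by (auto simp: b_def dest: sum.not_neutral_contains_not_neutral)
          (metis (mono_tags, lifting) mem_Collect_eq sum.neutral)
      then show ?thesis
        using supp K(2) normal_subgroup_intersect[OF _ Kn] by (auto simp: M_def)
    qed
    ultimately show ?thesis by blast
  qed
qed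

end

theorem theorem5p10:
  fixes G :: "('a, 'm) monoid_scheme"
  assumes "group G" and "finite (carrier G)"
  shows "(\<forall>N. N \<lhd> G \<longrightarrow>
            (\<exists>u\<in>Units (normal_burnside_ring G). core_coeff G N u \<noteq> 0) \<longleftrightarrow>
            elementary_abelian_2_group (G Mod N)) \<and>
         (\<Union>u\<in>Units (normal_burnside_ring G). {N. N \<lhd> G \<and> core_coeff G N u \<noteq> 0}) =
         {N. N \<lhd> G \<and> elementary_abelian_2_group (G Mod N)}"
proof -
  interpret finite_group G
    using assms by (simp add: finite_group_def finite_group_axioms_def)
  have "(\<exists>u\<in>Units (normal_burnside_ring G). core_coeff G N u \<noteq> 0) \<longleftrightarrow>
      elementary_abelian_2_group (G Mod N)" if N: "N \<lhd> G" for N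
    unfolding exists_unit_iff[OF N] elementary_abelian_2_group_Mod_iff[OF N]
    using contains_squares_if_coeff_nonzero[OF _ N] exists_unit_coeffs[of N] by blast
  then show ?thesis by auto
qed

end
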